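(* For any central, essential arrangement $\mathcal{A}$ of $n$ hyperplanes in $V=\mathbb{C}^\ell$, the variety $V(I(\mathcal{A}))$ of the logarithmic ideal is the closure of $\Sigma(\mathcal{A})$ in $V\times\mathbb{C}^n$.
   Context: Let $V=\mathbb{C}^\ell$ with coordinate ring $R=\mathbb{C}[x_1,\dots,x_\ell]$. Let $\mathcal{A}=\{H_1,\dots,H_n\}$ be a central, essential arrangement: the $H_i=\ker f_i$ are distinct hyperplanes through the origin, $f_i$ is a nonzero linear form, and $\mathcal{A}$ contains $\ell$ linearly independent hyperplanes. Put $Q=\prod_{i=1}^n f_i$ and $M=V\setminus\bigcup_i H_i$. Let $S=\mathbb{C}[a_1,\dots,a_n]\otimes_{\mathbb{C}}R$, the coordinate ring of $V\times\mathbb{C}^n$. For $\lambda\in\mathbb{C}^n$ let $\omega_\lambda=\sum_{i=1}^n\lambda_i\,df_i/f_i$, a one-form on $M$. Define $\Sigma(\mathcal{A})=\{(x,\lambda)\in M\times\mathbb{C}^n:\omega_\lambda(x)=0\}$. Let $\mathrm{Der}(\mathcal{A})=\{\theta\in \mathrm{Der}_{\mathbb{C}}(R): \theta(Q)\in (Q)\}$. The logarithmic ideal $I(\mathcal{A})$ is the ideal of $S$ generated by the polynomials $\sum_{i=1}^n a_i\,\theta(f_i)/f_i$ for $\theta\in\mathrm{Der}(\mathcal{A})$. *)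

theory Defs
  imports "HOL-Analysis.Analysis" "HOL-Library.Poly_Mapping"
begin

text \<open>
  A polynomial with complex coefficients in variables indexed by \<open>'v\<close> is a finitely supported
  function on monomials, and a monomial is a finitely supported exponent function. The ring
  operations are those of \<open>Poly_Mapping\<close> (convolution product).
\<close>

type_synonym 'v cpoly = "('v \<Rightarrow>\<^sub>0 nat) \<Rightarrow>\<^sub>0 complex"

definition Const :: "complex \<Rightarrow> 'v cpoly" where
  "Const z = Poly_Mapping.single 0 z"

definition Var :: "'v \<Rightarrow> 'v cpoly" where
  "Var v = Poly_Mapping.single (Poly_Mapping.single v 1) 1"

text \<open>
  Substitution of elements \<open>s v\<close> of a commutative ring for the variables; \<open>h\<close> is the map through
  which the coefficients act (the identity for evaluation at a point, \<open>Const\<close> for substitution of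
  polynomials).
\<close>

definition subst :: "(complex \<Rightarrow> 'b::comm_ring_1) \<Rightarrow> ('v \<Rightarrow> 'b) \<Rightarrow> 'v cpoly \<Rightarrow> 'b" where
  "subst h s p = (\<Sum>m\<in>Poly_Mapping.keys p.
     h (Poly_Mapping.lookup p m) * (\<Prod>v\<in>Poly_Mapping.keys m. s v ^ Poly_Mapping.lookup m v))"

definition eval_at :: "('v \<Rightarrow> complex) \<Rightarrow> 'v cpoly \<Rightarrow> complex" where
  "eval_at = subst (\<lambda>z. z)"

definition ideal_generated :: "'a::comm_ring_1 set \<Rightarrow> 'a set" where
  "ideal_generated = module.span (*)"

lemma module_times: "module ((*) :: 'a::comm_ring_1 \<Rightarrow> 'a \<Rightarrow> 'a)"
  by unfold_locales (simp_all add: algebra_simps)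

text \<open>Meaningful only when \<open>q\<close> is a non-zero-divisor that divides \<open>p\<close>.\<close>

definition exact_quotient :: "'a::comm_ring_1 \<Rightarrow> 'a \<Rightarrow> 'a" where
  "exact_quotient p q = (THE g. g * q = p)"

definition complex_derivation :: "('v cpoly \<Rightarrow> 'v cpoly) \<Rightarrow> bool" where
  "complex_derivation \<theta> \<longleftrightarrow>
     (\<forall>p q. \<theta> (p + q) = \<theta> p + \<theta> q) \<and>
     (\<forall>z p. \<theta> (Const z * p) = Const z * \<theta> p) \<and>
     (\<forall>p q. \<theta> (p * q) = \<theta> p * q + p * \<theta> q)"


text \<open>
  Here \<open>V\<close> is \<open>complex ^ 'l\<close>, its coordinate ring \<open>R\<close> is \<open>'l cpoly\<close>, and the hyperplanes are
  indexed by \<open>'n\<close>. The linear form \<open>f\<^sub>i\<close> is given by its coefficient vector \<open>c i\<close>.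
\<close>

definition linear_form :: "complex ^ 'l \<Rightarrow> ('l::finite) cpoly" where
  "linear_form a = (\<Sum>j\<in>UNIV. Const (a $ j) * Var j)"

definition form_at :: "complex ^ 'l \<Rightarrow> complex ^ ('l::finite) \<Rightarrow> complex" where
  "form_at a x = eval_at (($) x) (linear_form a)"

definition hyperplane :: "complex ^ 'l \<Rightarrow> (complex ^ ('l::finite)) set" where
  "hyperplane a = {x. form_at a x = 0}"

text \<open>Central arrangements: all hyperplanes pass through the origin.\<close>

definition central_arrangement :: "(('n::finite) \<Rightarrow> complex ^ ('l::finite)) \<Rightarrow> bool" where
  "central_arrangement c \<longleftrightarrow> (\<forall>i. c i \<noteq> 0) \<and> inj (\<lambda>i. hyperplane (c i))"

definition essential :: "(('n::finite) \<Rightarrow> complex ^ ('l::finite)) \<Rightarrow> bool" where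
  "essential c \<longleftrightarrow> (\<exists>J. inj_on c J \<and> card J = CARD('l) \<and> vec.independent (c ` J))"

definition defining_poly :: "(('n::finite) \<Rightarrow> complex ^ 'l) \<Rightarrow> ('l::finite) cpoly" where
  "defining_poly c = (\<Prod>i\<in>UNIV. linear_form (c i))"

definition complement :: "(('n::finite) \<Rightarrow> complex ^ 'l) \<Rightarrow> (complex ^ ('l::finite)) set" where
  "complement c = UNIV - (\<Union>i. hyperplane (c i))"

text \<open>
  The value at \<open>x\<close> of the one-form \<open>\<omega>\<^sub>\<lambda>\<close> is a covector, a function of the tangent vector \<open>u\<close>.
\<close>

definition omega ::
  "(('n::finite) \<Rightarrow> complex ^ 'l) \<Rightarrow> complex ^ 'n \<Rightarrow> complex ^ ('l::finite) \<Rightarrow> complex ^ 'l \<Rightarrow> complex"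
  where
  "omega c lam x = (\<lambda>u. \<Sum>i\<in>UNIV. lam $ i *
     (frechet_derivative (form_at (c i)) (at x) u / form_at (c i) x))"

definition Sigma_arr ::
  "(('n::finite) \<Rightarrow> complex ^ ('l::finite)) \<Rightarrow> ((complex ^ 'l) \<times> (complex ^ 'n)) set" where
  "Sigma_arr c = {(x, lam). x \<in> complement c \<and> omega c lam x = (\<lambda>u. 0)}"

definition log_derivations ::
  "(('n::finite) \<Rightarrow> complex ^ 'l) \<Rightarrow> (('l::finite) cpoly \<Rightarrow> 'l cpoly) set" where
  "log_derivations c =
     {\<theta>. complex_derivation \<theta> \<and> \<theta> (defining_poly c) \<in> ideal_generated {defining_poly c}}"


text \<open>
  The coordinate ring \<open>S\<close> of \<open>V \<times> \<complex>\<^sup>n\<close> is \<open>('l + 'n) cpoly\<close>: the variable \<open>Inl j\<close> is \<open>x\<^sub>j\<close> and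
  the variable \<open>Inr i\<close> is \<open>a\<^sub>i\<close>.
\<close>

definition embed_R :: "'l cpoly \<Rightarrow> ('l + 'n) cpoly" where
  "embed_R = subst Const (\<lambda>j. Var (Inl j))"

definition eval_S :: "(complex ^ 'l) \<times> (complex ^ 'n) \<Rightarrow> ('l::finite + 'n::finite) cpoly \<Rightarrow> complex"
  where
  "eval_S P = eval_at (case_sum (($) (fst P)) (($) (snd P)))"

text \<open>
  The division below is exact: a derivation that preserves \<open>(Q)\<close> preserves each \<open>(f\<^sub>i)\<close>, since the
  \<open>f\<^sub>i\<close> are pairwise non-proportional.
\<close>

definition log_ideal :: "(('n::finite) \<Rightarrow> complex ^ ('l::finite)) \<Rightarrow> ('l + 'n) cpoly set" where
  "log_ideal c = ideal_generated
     ((\<lambda>\<theta>. \<Sum>i\<in>UNIV. Var (Inr i) *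
         embed_R (exact_quotient (\<theta> (linear_form (c i))) (linear_form (c i))))
       ` log_derivations c)"

definition variety ::
  "('l::finite + 'n::finite) cpoly set \<Rightarrow> ((complex ^ 'l) \<times> (complex ^ 'n)) set" where
  "variety I = {P. \<forall>p\<in>I. eval_S P p = 0}"

text \<open>
  Closure in the Zariski topology of \<open>V \<times> \<complex>\<^sup>n\<close>, whose closed sets are the varieties. (For the
  constructible set \<open>Sigma_arr c\<close> it agrees with the Euclidean closure.)
\<close>

definition zariski_closed :: "((complex ^ 'l::finite) \<times> (complex ^ 'n::finite)) set \<Rightarrow> bool" where
  "zariski_closed Z \<longleftrightarrow> (\<exists>F. Z = variety F)"

definition zariski_closure ::
  "((complex ^ 'l::finite) \<times> (complex ^ 'n::finite)) set \<Rightarrow> ((complex ^ 'l) \<times> (complex ^ 'n)) set"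
  where
  "zariski_closure Z = zariski_closed hull Z"

end

theory Submission
  imports Defs
begin

text \<open>
  A point \<open>(x, \<lambda>)\<close> with \<open>x \<in> M\<close> lies on \<open>\<Sigma>\<close> iff \<open>\<lambda>\<^sub>i = \<mu>\<^sub>i f\<^sub>i(x)\<close> for a linear relation
  \<open>\<Sum>\<^sub>i \<mu>\<^sub>i f\<^sub>i = 0\<close> among the defining forms. So \<open>\<Sigma>\<close> consists of coordinatewise products
  of vectors from a linear space with vectors orthogonal to it, and the question is which points such
  products approach when \<open>x\<close> tends to the arrangement.

  The closure of \<open>\<Sigma>\<close> lies in the variety (\<open>Sigma_subset_variety\<close>), because at a point of \<open>\<Sigma>\<close>
  the generator that belongs to \<open>\<theta>\<close> is the value of \<open>\<omega>\<^sub>\<lambda>\<close> on a tangent vector; for this the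
  quotients \<open>\<theta>(f\<^sub>i)/f\<^sub>i\<close> must be honest polynomials (\<open>log_derivation_dvd\<close>).

  Conversely let \<open>(x, \<lambda>)\<close> lie in the variety and let \<open>E\<close> index the hyperplanes through \<open>x\<close>. Vector
  fields tangent to these hyperplanes, multiplied by the product of the other forms, are logarithmic
  derivations (\<open>variety_tangent_field\<close>). Constant ones show that \<open>\<Sum>\<^sub>i\<^sub>\<notin>\<^sub>E \<lambda>\<^sub>i f\<^sub>i / f\<^sub>i(x)\<close>
  is a linear combination of the \<open>f\<^sub>i\<close> with \<open>i \<in> E\<close>. Linear ones show that the part of \<open>\<lambda>\<close>
  indexed by \<open>E\<close> is orthogonal to every \<open>v\<close> whose coordinatewise action preserves the space \<open>L\<close> of
  the vectors \<open>(f\<^sub>i(y))\<^sub>i\<^sub>\<in>\<^sub>E\<close>. By the first condition the points of \<open>\<Sigma>\<close> approach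
  \<open>(x, \<lambda>)\<close> along a line as soon as that part of \<open>\<lambda>\<close> is a product \<open>g * \<nu>\<close> with \<open>g \<in> L\<close>
  without zero entries and \<open>\<nu>\<close> orthogonal to \<open>L\<close> (\<open>limit_of_critical_points\<close>). By the second
  condition it is in the Zariski closure of such products (\<open>products_dense\<close>), so every polynomial
  that vanishes on \<open>\<Sigma>\<close> vanishes at \<open>(x, \<lambda>)\<close>.

  The density of the products is the combinatorial core. It is proved by deletion and contraction
  of a coordinate; at each step one of the two acquires no new multipliers
  (\<open>multipliers_dichotomy\<close>).
\<close>

section \<open>Polynomials and their evaluation\<close>

lemma cpoly_induct_monomials:
  assumes "P 0" and "\<And>m z. P (Poly_Mapping.single m z)" and "\<And>p q. P p \<Longrightarrow> P q \<Longrightarrow> P (p + q)"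
  shows "P (p :: 'a \<Rightarrow>\<^sub>0 'b::comm_monoid_add)"
proof (induction p rule: Poly_Mapping.update_induct)
  case const
  show ?case by fact
next
  case (update f a b)
  have "Poly_Mapping.update a b f = Poly_Mapping.single a b + f"
    using update(1)
    by (intro poly_mapping_eqI)
       (auto simp: Poly_Mapping.lookup_update lookup_add lookup_single when_def in_keys_iff)
  then show ?case
    using assms update.IH by auto
qed

lemma cpoly_induct [case_names Const Var add mult]:
  assumes "\<And>z. P (Const z)" and "\<And>v. P (Var v)"
    and "\<And>p q. P p \<Longrightarrow> P q \<Longrightarrow> P (p + q)" and "\<And>p q. P p \<Longrightarrow> P q \<Longrightarrow> P (p * q)"
  shows "P (p :: 'v cpoly)"
proof -
  have one: "P (Poly_Mapping.single 0 1)"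
    using assms(1)[of 1] by (simp add: Const_def)
  have power: "P (Poly_Mapping.single (Poly_Mapping.single v k) 1)" for v k
  proof (induction k)
    case (Suc k)
    have "Poly_Mapping.single (Poly_Mapping.single v (Suc k)) (1::complex) =
        Var v * Poly_Mapping.single (Poly_Mapping.single v k) 1"
      unfolding Var_def mult_single by (simp flip: single_add)
    then show ?case
      using Suc assms(2,4) by simp
  qed (use one in simp)
  have monomial: "P (Poly_Mapping.single m 1)" for m
  proof (induction m rule: cpoly_induct_monomials)
    case (3 m m')
    have "Poly_Mapping.single (m + m') (1::complex) =
        Poly_Mapping.single m 1 * Poly_Mapping.single m' 1"
      by (simp add: mult_single)
    then show ?case
      using 3 assms(4) by simp
  qed (use one power in auto)
  show ?thesis
  proof (induction p rule: cpoly_induct_monomials)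
    case 1
    show ?case using assms(1)[of 0] by (simp add: Const_def)
  next
    case (2 m z)
    have "Poly_Mapping.single m z = Const z * Poly_Mapping.single m 1"
      by (simp add: Const_def mult_single)
    then show ?case
      using monomial assms(1,4) by simp
  qed (use assms(3) in auto)
qed

definition coeff_hom :: "(complex \<Rightarrow> 'b::comm_ring_1) \<Rightarrow> bool" where
  "coeff_hom h \<longleftrightarrow> h 0 = 0 \<and> h 1 = 1 \<and> (\<forall>a b. h (a + b) = h a + h b) \<and> (\<forall>a b. h (a * b) = h a * h b)"

lemma coeff_hom_id: "coeff_hom (\<lambda>z. z)"
  by (simp add: coeff_hom_def)

lemma coeff_hom_Const: "coeff_hom Const"
  by (simp add: coeff_hom_def Const_def single_add mult_single)

lemma monomial_superset:
  fixes s :: "'v \<Rightarrow> 'b::comm_ring_1"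
  assumes "finite A" and "Poly_Mapping.keys m \<subseteq> A"
  shows "(\<Prod>v\<in>Poly_Mapping.keys m. s v ^ Poly_Mapping.lookup m v) =
    (\<Prod>v\<in>A. s v ^ Poly_Mapping.lookup m v)"
  using assms by (intro prod.mono_neutral_left) (auto simp: in_keys_iff)

lemma monomial_add:
  fixes s :: "'v \<Rightarrow> 'b::comm_ring_1"
  shows "(\<Prod>v\<in>Poly_Mapping.keys (m + m'). s v ^ Poly_Mapping.lookup (m + m') v) =
    (\<Prod>v\<in>Poly_Mapping.keys m. s v ^ Poly_Mapping.lookup m v) *
    (\<Prod>v\<in>Poly_Mapping.keys m'. s v ^ Poly_Mapping.lookup m' v)"
proof -
  let ?A = "Poly_Mapping.keys m \<union> Poly_Mapping.keys m'"
  have "Poly_Mapping.keys (m + m') \<subseteq> ?A"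
    by (rule Poly_Mapping.keys_add)
  then show ?thesis
    by (subst (1 2 3) monomial_superset[of ?A])
       (auto simp: lookup_add power_add prod.distrib)
qed

lemma subst_superset:
  assumes "coeff_hom h" and "finite A" and "Poly_Mapping.keys p \<subseteq> A"
  shows "subst h s p = (\<Sum>m\<in>A.
     h (Poly_Mapping.lookup p m) * (\<Prod>v\<in>Poly_Mapping.keys m. s v ^ Poly_Mapping.lookup m v))"
  unfolding subst_def using assms
  by (intro sum.mono_neutral_left) (auto simp: in_keys_iff coeff_hom_def)

lemma subst_single:
  assumes "coeff_hom h"
  shows "subst h s (Poly_Mapping.single m z) =
    h z * (\<Prod>v\<in>Poly_Mapping.keys m. s v ^ Poly_Mapping.lookup m v)"
  by (subst subst_superset[OF assms, of "{m}"]) auto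

lemma subst_add:
  assumes "coeff_hom h"
  shows "subst h s (p + q) = subst h s p + subst h s q"
proof -
  let ?A = "Poly_Mapping.keys p \<union> Poly_Mapping.keys q"
  have "Poly_Mapping.keys (p + q) \<subseteq> ?A"
    by (rule Poly_Mapping.keys_add)
  then show ?thesis
    using assms
    by (subst (1 2 3) subst_superset[OF assms, of ?A])
       (auto simp: lookup_add coeff_hom_def sum.distrib distrib_right)
qed

lemma subst_0: "subst h s 0 = 0"
  by (simp add: subst_def)

lemma subst_mult:
  assumes h: "coeff_hom h"
  shows "subst h s (p * q) = subst h s p * subst h s q"
proof (induction p rule: cpoly_induct_monomials)
  case (2 m z)
  show ?case
  proof (induction q rule: cpoly_induct_monomials)
    case (2 m' z')
    show ?case
      using h by (simp only: mult_single subst_single[OF h] monomial_add)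
        (simp add: coeff_hom_def mult_ac)
  qed (simp_all add: distrib_left subst_add[OF h] subst_0)
qed (simp_all add: distrib_right subst_add[OF h] subst_0)

lemma subst_Const: "coeff_hom h \<Longrightarrow> subst h s (Const z) = h z"
  by (simp add: Const_def subst_single)

lemma subst_Var: "coeff_hom h \<Longrightarrow> subst h s (Var v) = s v"
  by (simp add: Var_def subst_single coeff_hom_def)

lemma Const_0: "Const 0 = 0" and Const_1: "Const 1 = 1"
  by (simp_all add: Const_def)

lemma
  shows eval_at_Const [simp]: "eval_at s (Const z) = z"
    and eval_at_Var [simp]: "eval_at s (Var v) = s v"
    and eval_at_add [simp]: "eval_at s (p + q) = eval_at s p + eval_at s q"
    and eval_at_mult [simp]: "eval_at s (p * q) = eval_at s p * eval_at s q"
  by (simp_all add: eval_at_def subst_Const subst_Var subst_add subst_mult coeff_hom_id)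

lemma eval_at_0 [simp]: "eval_at s 0 = 0" and eval_at_1 [simp]: "eval_at s 1 = 1"
  using eval_at_Const[of s 0] eval_at_Const[of s 1] by (simp_all add: Const_0 Const_1)

lemma eval_at_diff [simp]: "eval_at s (p - q) = eval_at s p - eval_at s q"
  using eval_at_add[of s "p - q" q] by (simp add: algebra_simps)

lemma eval_at_sum [simp]: "eval_at s (\<Sum>i\<in>A. p i) = (\<Sum>i\<in>A. eval_at s (p i))"
  by (induction A rule: infinite_finite_induct) auto

lemma eval_at_prod [simp]: "eval_at s (\<Prod>i\<in>A. p i) = (\<Prod>i\<in>A. eval_at s (p i))"
  by (induction A rule: infinite_finite_induct) auto

lemma eval_at_subst_Const: "eval_at s (subst Const t p) = eval_at (\<lambda>v. eval_at s (t v)) p"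
  by (induction p rule: cpoly_induct)
     (auto simp: subst_Const subst_Var subst_add subst_mult coeff_hom_Const)

lemma eval_S_embed_R: "eval_S P (embed_R p) = eval_at (($) (fst P)) p"
  by (simp add: eval_S_def embed_R_def eval_at_subst_Const)

text \<open>
  Distinct monomials are distinct multiplicative characters, so the argument is Dedekind's: if the
  monomials \<open>m \<noteq> m'\<close> occur in a vanishing combination, pick a scaling \<open>y\<close> of the variables that
  tells them apart; replacing \<open>x\<close> by \<open>x y\<close> and subtracting removes \<open>m'\<close> but not \<open>m\<close>.
\<close>

lemma monomials_independent:
  fixes a :: "('v::finite \<Rightarrow>\<^sub>0 nat) \<Rightarrow> complex"
  assumes "finite S" and "\<And>x. (\<Sum>m\<in>S. a m * (\<Prod>v\<in>UNIV. x v ^ Poly_Mapping.lookup m v)) = 0"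
    and "m \<in> S"
  shows "a m = 0"
  using assms
proof (induction S arbitrary: a m rule: finite_induct)
  case (insert m' S)
  define mono where "mono x m = (\<Prod>v\<in>UNIV. x v ^ Poly_Mapping.lookup m v)"
    for x :: "'v \<Rightarrow> complex" and m
  have mono_mult: "mono (\<lambda>v. x v * y v) m = mono x m * mono y m" for x y m
    by (simp add: mono_def power_mult_distrib prod.distrib)
  have vanish: "a m' * mono x m' + (\<Sum>m\<in>S. a m * mono x m) = 0" for x
    using insert.prems(1)[of x] insert.hyps by (simp add: mono_def)
  have on_S: "a m = 0" if "m \<in> S" for m
  proof -
    have "m \<noteq> m'"
      using that insert.hyps by auto
    then obtain w where w: "Poly_Mapping.lookup m w \<noteq> Poly_Mapping.lookup m' w"
      by (meson poly_mapping_eqI)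
    define y where "y v = (if v = w then 2 else 1 :: complex)" for v
    have mono_y: "mono y k = 2 ^ Poly_Mapping.lookup k w" for k
    proof -
      have "mono y k = (\<Prod>v\<in>UNIV. if v = w then 2 ^ Poly_Mapping.lookup k v else 1)"
        unfolding mono_def y_def by (intro prod.cong) auto
      then show ?thesis
        by (simp add: prod.delta)
    qed
    have "(\<Sum>k\<in>S. a k * (mono y k - mono y m') * mono x k) = 0" for x
    proof -
      have "(\<Sum>k\<in>S. a k * (mono y k - mono y m') * mono x k) =
          (\<Sum>k\<in>S. a k * mono (\<lambda>v. x v * y v) k) - mono y m' * (\<Sum>k\<in>S. a k * mono x k)"
        by (simp add: mono_mult algebra_simps sum_subtractf sum_distrib_left)
      also have "\<dots> = - (a m' * mono (\<lambda>v. x v * y v) m') + mono y m' * (a m' * mono x m')"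
      proof -
        have 1: "(\<Sum>k\<in>S. a k * mono (\<lambda>v. x v * y v) k) = - (a m' * mono (\<lambda>v. x v * y v) m')"
          using vanish[of "\<lambda>v. x v * y v"] by (simp add: eq_neg_iff_add_eq_0 add.commute)
        have 2: "(\<Sum>k\<in>S. a k * mono x k) = - (a m' * mono x m')"
          using vanish[of x] by (simp add: eq_neg_iff_add_eq_0 add.commute)
        show ?thesis
          unfolding 1 2 by simp
      qed
      also have "\<dots> = 0"
        by (simp add: mono_mult)
      finally show ?thesis .
    qed
    then have "a m * (mono y m - mono y m') = 0"
      using insert.IH[of "\<lambda>k. a k * (mono y k - mono y m')" m] that unfolding mono_def by simp
    moreover have "mono y m \<noteq> mono y m'"
    proof -
      have "of_nat (2 ^ Poly_Mapping.lookup m w) \<noteq> (of_nat (2 ^ Poly_Mapping.lookup m' w) :: complex)"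
        unfolding of_nat_eq_iff using w by simp
      then show ?thesis
        by (simp add: mono_y)
    qed
    ultimately show ?thesis
      by simp
  qed
  then have "a m' = 0"
    using vanish[of "\<lambda>_. 1"] by (simp add: mono_def)
  then show ?case
    using on_S insert.prems(2) by auto
qed simp

lemma cpoly_eq_0I:
  fixes p :: "'v::finite cpoly"
  assumes "\<And>s. eval_at s p = 0"
  shows "p = 0"
proof (rule poly_mapping_eqI)
  fix m
  have "(\<Sum>m\<in>Poly_Mapping.keys p. Poly_Mapping.lookup p m *
      (\<Prod>v\<in>UNIV. s v ^ Poly_Mapping.lookup m v)) = 0" for s
    using assms[of s] unfolding eval_at_def subst_def
    by (subst (asm) monomial_superset[of UNIV]) auto
  then have "Poly_Mapping.lookup p m = 0" if "m \<in> Poly_Mapping.keys p"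
    using that monomials_independent[of "Poly_Mapping.keys p" "Poly_Mapping.lookup p"] by simp
  then show "Poly_Mapping.lookup p m = Poly_Mapping.lookup 0 m"
    by (auto simp: in_keys_iff)
qed

lemma cpoly_eqI:
  fixes p q :: "'v::finite cpoly"
  assumes "\<And>x :: complex ^ 'v. eval_at (($) x) p = eval_at (($) x) q"
  shows "p = q"
proof -
  have "eval_at s (p - q) = 0" for s
  proof -
    have "(($) (\<chi> v. s v)) = s" by auto
    then show ?thesis using assms[of "\<chi> v. s v"] by simp
  qed
  then show ?thesis
    using cpoly_eq_0I by fastforce
qed

lemma continuous_eval_at:
  fixes s :: "'a::topological_space \<Rightarrow> 'v \<Rightarrow> complex"
  assumes "\<And>v. continuous_on X (\<lambda>t. s t v)"
  shows "continuous_on X (\<lambda>t. eval_at (s t) p)"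
  by (induction p rule: cpoly_induct) (auto intro!: continuous_intros assms)

section \<open>Linear forms and division by them\<close>

lemma form_at_eq: "form_at a x = (\<Sum>j\<in>UNIV. a $ j * x $ j)"
  by (simp add: form_at_def linear_form_def)

lemma eval_linear_form [simp]: "eval_at (($) x) (linear_form a) = form_at a x"
  by (simp add: form_at_def)

lemma form_at_simps [simp]:
  "form_at a (x + y) = form_at a x + form_at a y"
  "form_at a (x - y) = form_at a x - form_at a y"
  "form_at a (z *s x) = z * form_at a x"
  "form_at a 0 = 0"
  by (simp_all add: form_at_eq sum.distrib sum_subtractf sum_distrib_left algebra_simps)

lemma form_at_axis: "form_at a (axis k z) = a $ k * z"
  by (simp add: form_at_eq axis_def if_distrib[of "\<lambda>u. _ * u"] cong: if_cong)

lemma form_at_sum: "form_at a (\<Sum>k\<in>A. x k) = (\<Sum>k\<in>A. form_at a (x k))"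
  by (induction A rule: infinite_finite_induct) auto

lemma form_at_nonzero:
  assumes "a \<noteq> 0"
  obtains b where "form_at a b = 1"
proof -
  obtain k where "a $ k \<noteq> 0"
    using assms by (auto simp: vec_eq_iff)
  then show ?thesis
    using that[of "axis k (1 / a $ k)"] by (simp add: form_at_axis)
qed

lemma continuous_form_at [continuous_intros]:
  "continuous_on X g \<Longrightarrow> continuous_on X (\<lambda>t. form_at a (g t))"
  unfolding form_at_eq by (intro continuous_intros)

lemma continuous_vec_scale [continuous_intros]:
  fixes g :: "'a::topological_space \<Rightarrow> complex" and w :: "'a \<Rightarrow> complex ^ 'n"
  assumes "continuous_on X g" and "continuous_on X w"
  shows "continuous_on X (\<lambda>t. g t *s w t)"
  unfolding vector_scalar_mult_def using assms by (intro continuous_intros)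

text \<open>
  Used on the parameter of a line that leaves a given point in a generic direction: what holds at
  all but finitely many points of the line holds at the given point.
\<close>

lemma zero_off_finite_imp_zero:
  fixes g :: "complex \<Rightarrow> complex"
  assumes "continuous_on UNIV g" and "finite B" and "\<And>t. t \<notin> B \<Longrightarrow> g t = 0"
  shows "g t = 0"
proof -
  have "closed (g -` {0})"
    using assms(1) by (intro continuous_closed_vimage) (auto simp: continuous_on_eq_continuous_at)
  moreover have "- B \<subseteq> g -` {0}"
    using assms(3) by auto
  moreover have "closure (- B) = UNIV"
    using empty_interior_finite[OF assms(2)] by (simp add: closure_complement)
  ultimately have "UNIV \<subseteq> g -` {0}"
    using closure_minimal by metis
  then show ?thesis by auto
qed

lemma exists_off_finite:
  assumes "finite (B :: complex set)"
  obtains t where "t \<notin> B"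
  using ex_new_if_finite[OF infinite_UNIV_char_0 assms] by blast

lemma finite_affine_zeros:
  fixes u v :: complex
  assumes "u \<noteq> 0 \<or> v \<noteq> 0"
  shows "finite {t. u + t * v = 0}"
proof (cases "v = 0")
  case False
  have "{t. u + t * v = 0} \<subseteq> {- u / v}"
    using False by (auto simp: field_simps eq_neg_iff_add_eq_0)
  then show ?thesis
    using finite_subset by blast
qed (use assms in auto)

text \<open>A vector space over an infinite field is not a finite union of proper subspaces.\<close>

lemma generic_vector:
  assumes "vec.subspace W" and "finite F" and "\<And>i. i \<in> F \<Longrightarrow> \<exists>w\<in>W. form_at (c i) w \<noteq> 0"
  shows "\<exists>w\<in>W. \<forall>i\<in>F. form_at (c i) w \<noteq> 0"
  using assms(2,3)
proof (induction F rule: finite_induct)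
  case empty
  show ?case
    using vec.subspace_0[OF assms(1)] by auto
next
  case (insert i F)
  obtain w where w: "w \<in> W" "\<forall>j\<in>F. form_at (c j) w \<noteq> 0"
    using insert by blast
  obtain w' where w': "w' \<in> W" "form_at (c i) w' \<noteq> 0"
    using insert.prems by blast
  have "finite (\<Union>j\<in>insert i F. {t. form_at (c j) w + t * form_at (c j) w' = 0})"
    using insert.hyps w w' by (intro finite_UN_I finite_affine_zeros) auto
  then obtain t where "\<forall>j\<in>insert i F. form_at (c j) w + t * form_at (c j) w' \<noteq> 0"
    by (rule exists_off_finite) auto
  moreover have "w + t *s w' \<in> W"
    using w w' assms(1) by (simp add: vec.subspace_add vec.subspace_scale)
  ultimately show ?case
    by (intro bexI[of _ "w + t *s w'"]) auto
qed

text \<open>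
  With \<open>f(b) = 1\<close>, the substitution \<open>x \<mapsto> x - f(x) b\<close> projects onto the hyperplane \<open>f = 0\<close> and changes
  a polynomial by a multiple of \<open>f\<close>. For a polynomial that vanishes on the hyperplane the
  result of the substitution is zero.
\<close>

lemma linear_form_dvdI:
  assumes "a \<noteq> 0" and "\<And>x. form_at a x = 0 \<Longrightarrow> eval_at (($) x) g = 0"
  shows "\<exists>q. g = q * linear_form a"
proof -
  obtain b where b: "form_at a b = 1"
    using form_at_nonzero[OF assms(1)] .
  define t where "t j = Var j - Const (b $ j) * linear_form a" for j
  have "\<exists>q. p = subst Const t p + q * linear_form a" for p
  proof (induction p rule: cpoly_induct)
    case (Const z)
    show ?case
      by (rule exI[of _ 0]) (simp add: subst_Const coeff_hom_Const)
  next
    case (Var v)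
    show ?case
      by (rule exI[of _ "Const (b $ v)"]) (simp add: subst_Var coeff_hom_Const t_def)
  next
    case (add p q)
    then obtain p' q' where p': "p = subst Const t p + p' * linear_form a"
      and q': "q = subst Const t q + q' * linear_form a" by blast
    show ?case
      by (rule exI[of _ "p' + q'"], subst p', subst q')
         (simp add: subst_add coeff_hom_Const algebra_simps)
  next
    case (mult p q)
    then obtain p' q' where p': "p = subst Const t p + p' * linear_form a"
      and q': "q = subst Const t q + q' * linear_form a" by blast
    let ?P = "subst Const t p" and ?Q = "subst Const t q"
    have "p * q = (?P + p' * linear_form a) * (?Q + q' * linear_form a)"
      using p' q' by simp
    also have "\<dots> = subst Const t (p * q) + (p' * q + ?P * q') * linear_form a"
      by (subst q') (simp add: subst_mult coeff_hom_Const algebra_simps)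
    finally show ?case by blast
  qed
  then obtain q where q: "g = subst Const t g + q * linear_form a"
    by blast
  have "subst Const t g = 0"
  proof (rule cpoly_eqI)
    fix x
    have "(\<lambda>v. x $ v - form_at a x * b $ v) = ($) (x - form_at a x *s b)"
      by auto
    then have "eval_at (($) x) (subst Const t g) = eval_at (($) (x - form_at a x *s b)) g"
      by (simp add: eval_at_subst_Const t_def mult.commute)
    also have "\<dots> = 0"
      using assms(2) by (simp add: b)
    finally show "eval_at (($) x) (subst Const t g) = eval_at (($) x) 0"
      by simp
  qed
  then show ?thesis
    using q by auto
qed

lemma linear_form_cancel:
  assumes "a \<noteq> 0" and "p * linear_form a = q * linear_form a"
  shows "p = q"
proof (rule cpoly_eqI)
  fix x
  obtain b where b: "form_at a b = 1"
    using form_at_nonzero[OF assms(1)] .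
  have "eval_at (($) (x + 0 *s b)) (p - q) = 0"
  proof (rule zero_off_finite_imp_zero[of "\<lambda>t. eval_at (($) (x + t *s b)) (p - q)"])
    show "continuous_on UNIV (\<lambda>t. eval_at (($) (x + t *s b)) (p - q))"
      by (intro continuous_eval_at continuous_intros)
    show "finite {- form_at a x}"
      by simp
    fix t assume "t \<notin> {- form_at a x}"
    then have "form_at a (x + t *s b) \<noteq> 0"
      by (simp add: b eq_neg_iff_add_eq_0 add.commute)
    moreover have "eval_at (($) (x + t *s b)) (p * linear_form a) =
        eval_at (($) (x + t *s b)) (q * linear_form a)"
      using assms(2) by simp
    ultimately show "eval_at (($) (x + t *s b)) (p - q) = 0"
      by (simp del: form_at_simps)
  qed
  then show "eval_at (($) x) p = eval_at (($) x) q"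
    by simp
qed

lemma exact_quotient_eq:
  assumes "a \<noteq> 0" and "p = q * linear_form a"
  shows "exact_quotient p (linear_form a) = q"
  unfolding exact_quotient_def using assms linear_form_cancel by (intro the_equality) auto


section \<open>Logarithmic derivations\<close>

lemma complex_derivation_0:
  assumes "complex_derivation \<theta>"
  shows "\<theta> 0 = 0"
proof -
  have "\<theta> (0 + 0) = \<theta> 0 + \<theta> 0"
    using assms unfolding complex_derivation_def by blast
  then show ?thesis by simp
qed

lemma complex_derivation_sum:
  assumes "complex_derivation \<theta>"
  shows "\<theta> (\<Sum>i\<in>A. p i) = (\<Sum>i\<in>A. \<theta> (p i))"
  using assms complex_derivation_0[OF assms]
  by (induction A rule: infinite_finite_induct) (auto simp: complex_derivation_def)

lemma complex_derivation_linear_form: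
  assumes "complex_derivation \<theta>"
  shows "\<theta> (linear_form a) = (\<Sum>j\<in>UNIV. Const (a $ j) * \<theta> (Var j))"
proof -
  have "\<theta> (Const z * p) = Const z * \<theta> p" for z p
    using assms unfolding complex_derivation_def by blast
  then show ?thesis
    by (simp add: linear_form_def complex_derivation_sum[OF assms])
qed

lemma eval_derivation_linear_form:
  assumes "complex_derivation \<theta>"
  shows "eval_at (($) x) (\<theta> (linear_form a)) = form_at a (\<chi> j. eval_at (($) x) (\<theta> (Var j)))"
  by (simp add: complex_derivation_linear_form[OF assms] form_at_eq)

text \<open>A hyperplane is a maximal proper subspace, so distinct hyperplanes are incomparable.\<close>

lemma hyperplane_not_subset:
  assumes "central_arrangement c" and "i \<noteq> j"
  shows "\<exists>w\<in>hyperplane (c i). form_at (c j) w \<noteq> 0"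
proof (rule ccontr)
  assume "\<not> ?thesis"
  then have sub: "form_at (c j) w = 0" if "form_at (c i) w = 0" for w
    using that by (auto simp: hyperplane_def)
  have "hyperplane (c i) \<noteq> hyperplane (c j)"
    using assms by (auto simp: central_arrangement_def dest: injD)
  then obtain y where y: "form_at (c j) y = 0" "form_at (c i) y \<noteq> 0"
    using sub by (auto simp: hyperplane_def)
  obtain z where z: "form_at (c j) z = 1"
    using form_at_nonzero[of "c j"] assms by (auto simp: central_arrangement_def)
  have "form_at (c j) (z - (form_at (c i) z / form_at (c i) y) *s y) = 0"
    using y by (intro sub) simp
  then show False
    using y z by simp
qed

lemma subspace_hyperplane: "vec.subspace (hyperplane a)"
  by (auto simp: vec.subspace_def hyperplane_def)

text \<open>
  On \<open>H\<^sub>i\<close> the Leibniz rule leaves only \<open>\<theta>(f\<^sub>i)\<close> times the product of the other forms in \<open>\<theta>(Q)\<close>, and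
  the other forms do not vanish at a generic point of \<open>H\<^sub>i\<close>. So \<open>\<theta>(f\<^sub>i)\<close> vanishes on a dense subset of
  \<open>H\<^sub>i\<close>.
\<close>

lemma log_derivation_dvd:
  assumes "central_arrangement c" and "\<theta> \<in> log_derivations c"
  shows "\<exists>q. \<theta> (linear_form (c i)) = q * linear_form (c i)"
proof (rule linear_form_dvdI)
  let ?f = "\<lambda>i. linear_form (c i)"
  show "c i \<noteq> 0"
    using assms(1) by (auto simp: central_arrangement_def)
  have der: "complex_derivation \<theta>"
    using assms(2) by (simp add: log_derivations_def)
  define R where "R = (\<Prod>j\<in>UNIV - {i}. ?f j)"
  have Q: "defining_poly c = ?f i * R"
    unfolding defining_poly_def R_def by (rule prod.remove) auto
  have "\<theta> (defining_poly c) \<in> range (\<lambda>k. k * defining_poly c)"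
    using assms(2) unfolding log_derivations_def ideal_generated_def
    by (simp flip: module.span_singleton[OF module_times])
  then obtain k where "\<theta> (?f i * R) = k * (?f i * R)"
    unfolding Q by auto
  then have leibniz: "\<theta> (?f i) * R + ?f i * \<theta> R = k * (?f i * R)"
    using der by (simp add: complex_derivation_def)
  have generic: "eval_at (($) x) (\<theta> (?f i)) = 0"
    if "form_at (c i) x = 0" and "\<forall>j\<in>UNIV - {i}. form_at (c j) x \<noteq> 0" for x
    using that arg_cong[OF leibniz, of "eval_at (($) x)"] by (auto simp: R_def)
  obtain w where w: "form_at (c i) w = 0" "\<forall>j\<in>UNIV - {i}. form_at (c j) w \<noteq> 0"
    using generic_vector[OF subspace_hyperplane[of "c i"], of "UNIV - {i}" c]
      hyperplane_not_subset[OF assms(1), of i]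
    by (auto simp: hyperplane_def)
  fix x assume x: "form_at (c i) x = 0"
  have "eval_at (($) (x + 0 *s w)) (\<theta> (?f i)) = 0"
  proof (rule zero_off_finite_imp_zero[of "\<lambda>t. eval_at (($) (x + t *s w)) (\<theta> (?f i))"])
    show "continuous_on UNIV (\<lambda>t. eval_at (($) (x + t *s w)) (\<theta> (?f i)))"
      by (intro continuous_eval_at continuous_intros)
    let ?B = "\<Union>j\<in>UNIV - {i}. {t. form_at (c j) x + t * form_at (c j) w = 0}"
    show "finite ?B"
      using w by (intro finite_UN_I finite_affine_zeros) auto
    fix t assume "t \<notin> ?B"
    then show "eval_at (($) (x + t *s w)) (\<theta> (?f i)) = 0"
      using x w by (intro generic) auto
  qed
  then show "eval_at (($) x) (\<theta> (?f i)) = 0"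
    by simp
qed

lemma frechet_derivative_form_at: "frechet_derivative (form_at a) (at x) = form_at a"
proof -
  have "bounded_linear (form_at a)"
    unfolding linear_conv_bounded_linear[symmetric]
  proof (rule linearI)
    fix r :: real and x :: "complex ^ 'a"
    show "form_at a (r *\<^sub>R x) = r *\<^sub>R form_at a x"
      by (simp add: form_at_eq scaleR_right.sum)
  qed simp
  then show ?thesis
    using frechet_derivative_at[OF bounded_linear_imp_has_derivative] by metis
qed

lemma Sigma_arr_eq:
  "(x, lam) \<in> Sigma_arr c \<longleftrightarrow> (\<forall>i. form_at (c i) x \<noteq> 0) \<and>
    (\<forall>u. (\<Sum>i\<in>UNIV. lam $ i * (form_at (c i) u / form_at (c i) x)) = 0)"
  by (auto simp: Sigma_arr_def complement_def hyperplane_def omega_def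
      frechet_derivative_form_at fun_eq_iff)

lemma eval_S_0 [simp]: "eval_S P 0 = 0"
  and eval_S_add [simp]: "eval_S P (p + q) = eval_S P p + eval_S P q"
  and eval_S_mult [simp]: "eval_S P (p * q) = eval_S P p * eval_S P q"
  by (simp_all add: eval_S_def)

lemma variety_ideal_generated: "variety (ideal_generated G) = variety G"
proof -
  have "eval_S P p = 0" if "\<forall>g\<in>G. eval_S P g = 0" and "p \<in> module.span (*) G" for P p
    using that(2)
  proof (induction rule: module.span_induct_alt[OF module_times, consumes 1])
    case 1
    show ?case by simp
  next
    case (2 k g q)
    then show ?case
      using that(1) by simp
  qed
  then show ?thesis
    using module.span_superset[OF module_times, of G]
    by (auto simp: variety_def ideal_generated_def)
qed

lemma log_generator_eval:
  "eval_S (x, lam) (\<Sum>i\<in>UNIV. Var (Inr i) * embed_R (q i)) = (\<Sum>i\<in>UNIV. lam $ i * eval_at (($) x) (q i))"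
  using eval_S_embed_R[of "(x, lam)"] by (simp add: eval_S_def)

text \<open>At a point of \<open>\<Sigma>\<close> a generator of the ideal is \<open>\<omega>\<^sub>\<lambda>\<close> applied to the tangent vector \<open>\<theta>\<close>.\<close>

lemma Sigma_subset_variety:
  assumes "central_arrangement c"
  shows "Sigma_arr c \<subseteq> variety (log_ideal c)"
proof -
  have "eval_S (x, lam) (\<Sum>i\<in>UNIV. Var (Inr i) *
      embed_R (exact_quotient (\<theta> (linear_form (c i))) (linear_form (c i)))) = 0"
    if S: "(x, lam) \<in> Sigma_arr c" and \<theta>: "\<theta> \<in> log_derivations c" for x lam \<theta>
  proof -
    have der: "complex_derivation \<theta>"
      using \<theta> by (simp add: log_derivations_def)
    let ?u = "\<chi> j. eval_at (($) x) (\<theta> (Var j))"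
    have "eval_at (($) x) (exact_quotient (\<theta> (linear_form (c i))) (linear_form (c i))) =
        form_at (c i) ?u / form_at (c i) x" for i
    proof -
      obtain q where q: "\<theta> (linear_form (c i)) = q * linear_form (c i)"
        using log_derivation_dvd[OF assms \<theta>] by blast
      have "form_at (c i) ?u = eval_at (($) x) q * form_at (c i) x"
        using eval_derivation_linear_form[OF der, of x "c i"] by (simp add: q)
      moreover have "c i \<noteq> 0"
        using assms by (auto simp: central_arrangement_def)
      ultimately show ?thesis
        using S by (simp add: exact_quotient_eq[OF _ q] Sigma_arr_eq)
    qed
    then show ?thesis
      using S by (simp add: log_generator_eval Sigma_arr_eq)
  qed
  then show ?thesis
    unfolding log_ideal_def variety_ideal_generated by (auto simp: variety_def)
qed

text \<open>
  Every polynomial vector field is a derivation: the value of \<open>p\<close> under it is the polynomial whose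
  value at \<open>x\<close> is the directional derivative of \<open>p\<close> along \<open>h(x)\<close>. The derivation laws then
  follow from those of calculus, since a polynomial is determined by its values.
\<close>

lemma exists_derivation:
  fixes h :: "'l::finite \<Rightarrow> 'l cpoly"
  shows "\<exists>\<theta>. complex_derivation \<theta> \<and> (\<forall>j. \<theta> (Var j) = h j)"
proof -
  define line where "line x t = (\<lambda>j. x $ j + t * eval_at (($) x) (h j))" for x :: "complex ^ 'l" and t
  define along where "along p q \<longleftrightarrow>
      (\<forall>x. ((\<lambda>t. eval_at (line x t) p) has_field_derivative eval_at (($) x) q) (at 0))" for p q
  have line_0: "line x 0 = ($) x" for x
    by (auto simp: line_def)
  have along_Const: "along (Const z) 0" for z
    by (simp add: along_def)
  have along_Var: "along (Var j) (h j)" for j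
    unfolding along_def line_def by (auto intro!: derivative_eq_intros)
  have along_add: "along (p + q) (p' + q')" if "along p p'" "along q q'" for p q p' q'
    using that by (auto simp: along_def intro!: derivative_eq_intros)
  have along_mult: "along (p * q) (p' * q + p * q')" if "along p p'" "along q q'" for p q p' q'
    using that unfolding along_def by (auto intro!: derivative_eq_intros simp: line_0)
  have "\<exists>q. along p q" for p
    using along_Const along_Var along_add along_mult
    by (induction p rule: cpoly_induct) blast+
  then obtain \<theta> where \<theta>: "along p (\<theta> p)" for p
    by metis
  have eq: "\<theta> p = q" if "along p q" for p q
    using DERIV_unique \<theta>[of p] that unfolding along_def by (blast intro: cpoly_eqI)
  have "\<theta> (p + q) = \<theta> p + \<theta> q" for p q
    using eq[OF along_add] \<theta> by blast
  moreover have mult: "\<theta> (p * q) = \<theta> p * q + p * \<theta> q" for p q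
    using eq[OF along_mult] \<theta> by blast
  moreover have "\<theta> (Const z * p) = Const z * \<theta> p" for z p
    unfolding mult using eq[OF along_Const] by simp
  ultimately have "complex_derivation \<theta>"
    unfolding complex_derivation_def by blast
  then show ?thesis
    using eq[OF along_Var] by blast
qed

lemma derivation_prod_eigen:
  assumes "complex_derivation \<theta>" and "\<And>i. i \<in> A \<Longrightarrow> \<theta> (f i) = g i * f i"
  shows "\<theta> (\<Prod>i\<in>A. f i) = (\<Sum>i\<in>A. g i) * (\<Prod>i\<in>A. f i)"
proof -
  have mult: "\<theta> (p * q) = \<theta> p * q + p * \<theta> q" for p q
    using assms(1) by (simp add: complex_derivation_def)
  have one: "\<theta> 1 = 0"
    using mult[of 1 1] by simp
  show ?thesis
    using assms(2)
  proof (induction A rule: infinite_finite_induct)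
    case (insert i A)
    then have "\<theta> (f i) = g i * f i" and "\<theta> (prod f A) = sum g A * prod f A"
      by auto
    then have "\<theta> (f i * prod f A) = (g i + sum g A) * (f i * prod f A)"
      unfolding mult by (simp only: ring_distribs ac_simps)
    then show ?case
      using insert.hyps by simp
  qed (simp_all add: one)
qed

text \<open>
  The vector field \<open>B\<close> is tangent to the hyperplanes through \<open>x\<close>, with multipliers \<open>v\<close>; multiplied by the
  product of the other forms it becomes tangent to all of them. This product is not zero at \<open>x\<close>,
  so the value at \<open>x\<close> of the corresponding generator can be divided by it.
\<close>

lemma variety_tangent_field:
  fixes c :: "'n::finite \<Rightarrow> complex ^ 'l::finite"
  assumes c: "central_arrangement c" and P: "(x, lam) \<in> variety (log_ideal c)"
    and B: "\<And>i y. form_at (c i) x = 0 \<Longrightarrow>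
      form_at (c i) (\<chi> j. eval_at (($) y) (B j)) = v i * form_at (c i) y"
  shows "(\<Sum>i | form_at (c i) x = 0. lam $ i * v i) +
    (\<Sum>i | form_at (c i) x \<noteq> 0. lam $ i *
      (form_at (c i) (\<chi> j. eval_at (($) x) (B j)) / form_at (c i) x)) = 0"
proof -
  let ?f = "\<lambda>i. linear_form (c i)"
  let ?E = "{i. form_at (c i) x = 0}"
  define R where "R = (\<Prod>k\<in>-?E. ?f k)"
  define b where "b i = (\<Sum>j\<in>UNIV. Const (c i $ j) * B j)" for i
  have eval_b: "eval_at (($) y) (b i) = form_at (c i) (\<chi> j. eval_at (($) y) (B j))" for y i
    by (simp add: b_def form_at_eq)
  have b_eigen: "b i = Const (v i) * ?f i" if "i \<in> ?E" for i
  proof (rule cpoly_eqI)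
    fix y
    show "eval_at (($) y) (b i) = eval_at (($) y) (Const (v i) * ?f i)"
      using that B[of i y] by (simp add: eval_b)
  qed
  obtain \<theta> where der: "complex_derivation \<theta>" and \<theta>_Var: "\<And>j. \<theta> (Var j) = R * B j"
    using exists_derivation[of "\<lambda>j. R * B j"] by blast
  have \<theta>_f: "\<theta> (?f i) = R * b i" for i
    by (simp add: complex_derivation_linear_form[OF der] \<theta>_Var b_def sum_distrib_left mult_ac)
  define g where "g i = (if i \<in> ?E then Const (v i) * R else b i * (\<Prod>k\<in>-?E - {i}. ?f k))" for i
  have g: "\<theta> (?f i) = g i * ?f i" for i
  proof (cases "i \<in> ?E")
    case True
    then show ?thesis
      using b_eigen[OF True] by (simp add: \<theta>_f g_def mult_ac)
  next
    case False
    then have "R = ?f i * (\<Prod>k\<in>-?E - {i}. ?f k)"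
      unfolding R_def by (intro prod.remove) auto
    then show ?thesis
      using False by (simp add: \<theta>_f g_def mult_ac)
  qed
  have "\<theta> (defining_poly c) = (\<Sum>i\<in>UNIV. g i) * defining_poly c"
    unfolding defining_poly_def by (rule derivation_prod_eigen[OF der g])
  then have "\<theta> \<in> log_derivations c"
    using der unfolding log_derivations_def ideal_generated_def
    by (auto simp: module.span_singleton[OF module_times])
  moreover have "exact_quotient (\<theta> (?f i)) (?f i) = g i" for i
    using c by (intro exact_quotient_eq g) (auto simp: central_arrangement_def)
  ultimately have "eval_S (x, lam) (\<Sum>i\<in>UNIV. Var (Inr i) * embed_R (g i)) = 0"
    using P unfolding log_ideal_def variety_ideal_generated by (force simp: variety_def)
  then have zero: "(\<Sum>i\<in>UNIV. lam $ i * eval_at (($) x) (g i)) = 0"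
    by (simp add: log_generator_eval)
  let ?r = "eval_at (($) x) R"
  have r: "?r \<noteq> 0"
    by (auto simp: R_def)
  have "eval_at (($) x) (g i) = ?r * (if i \<in> ?E then v i else
      form_at (c i) (\<chi> j. eval_at (($) x) (B j)) / form_at (c i) x)" for i
  proof (cases "i \<in> ?E")
    case False
    have "?r * eval_at (($) x) (b i) = eval_at (($) x) (g i) * form_at (c i) x"
      using arg_cong[OF g[of i], of "eval_at (($) x)"] by (simp add: \<theta>_f)
    then show ?thesis
      using False by (simp add: eval_b field_simps)
  qed (simp add: g_def)
  then have "?r * (\<Sum>i\<in>UNIV. lam $ i * (if i \<in> ?E then v i else
      form_at (c i) (\<chi> j. eval_at (($) x) (B j)) / form_at (c i) x)) = 0"
    using zero by (simp add: sum_distrib_left mult_ac)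
  then have "(\<Sum>i\<in>UNIV. lam $ i * (if i \<in> ?E then v i else
      form_at (c i) (\<chi> j. eval_at (($) x) (B j)) / form_at (c i) x)) = 0"
    using r by simp
  moreover have "UNIV = ?E \<union> -?E"
    by auto
  ultimately have "(\<Sum>i\<in>?E \<union> -?E. lam $ i * (if i \<in> ?E then v i else
      form_at (c i) (\<chi> j. eval_at (($) x) (B j)) / form_at (c i) x)) = 0"
    by simp
  then show ?thesis
    by (subst (asm) sum.union_disjoint) (auto simp: Compl_eq)
qed

section \<open>Coordinatewise products of orthogonal vectors\<close>

text \<open>The bilinear form \<open>form_at a b\<close> serves as the pairing on \<open>\<complex>\<^sup>n\<close>.\<close>

definition annihilator :: "(complex ^ 'n::finite) set \<Rightarrow> (complex ^ 'n) set" where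
  "annihilator L = {\<nu>. \<forall>g\<in>L. form_at \<nu> g = 0}"

definition multipliers :: "(complex ^ 'n::finite) set \<Rightarrow> (complex ^ 'n) set" where
  "multipliers L = {v. \<forall>g\<in>L. v * g \<in> L}"

lemma form_at_commute: "form_at a b = form_at b a"
  by (simp add: form_at_eq mult.commute)

lemma subspace_annihilator: "vec.subspace (annihilator L)"
  by (auto simp: vec.subspace_def annihilator_def form_at_commute[of _ "_ :: complex ^ 'a"])

text \<open>
  The conjugate of the component of \<open>x\<close> orthogonal to \<open>L\<close> pairs with \<open>x\<close> to the square of its norm.
\<close>

lemma annihilator_separates:
  fixes L :: "(complex ^ 'n::finite) set"
  assumes L: "vec.subspace L" and x: "x \<notin> L"
  shows "\<exists>\<nu>\<in>annihilator L. form_at \<nu> x \<noteq> 0"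
proof -
  have scaleR: "r *\<^sub>R w = of_real r *s w" for r :: real and w :: "complex ^ 'n"
  proof -
    have "(r *\<^sub>R w) $ i = (of_real r *s w) $ i" for i
      unfolding vector_scaleR_component vector_smult_component by (rule scaleR_conv_of_real)
    then show ?thesis
      unfolding vec_eq_iff by blast
  qed
  have sub: "subspace L"
    unfolding subspace_def scaleR
    using vec.subspace_0[OF L] vec.subspace_add[OF L] vec.subspace_scale[OF L] by blast
  obtain y z where "y \<in> span L" and orth: "\<And>w. w \<in> span L \<Longrightarrow> orthogonal z w"
    and xyz: "x = y + z"
    using orthogonal_subspace_decomp_exists[of L x] by blast
  then have y: "y \<in> L"
    using sub by (metis span_eq_iff)
  define \<nu> where "\<nu> = (\<chi> i. cnj (z $ i))"
  have inner: "z \<bullet> w = Re (form_at \<nu> w)" for w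
    by (simp add: inner_vec_def form_at_eq \<nu>_def inner_complex_def)
  have "form_at \<nu> w = 0" if "w \<in> L" for w
  proof -
    have re: "Re (form_at \<nu> w') = 0" if "w' \<in> L" for w'
      using orth[of w'] that span_superset[of L] by (auto simp: orthogonal_def inner)
    have "Re (form_at \<nu> w) = 0" and "Re (form_at \<nu> (\<i> *s w)) = 0"
      by (rule re[OF that], rule re[OF vec.subspace_scale[OF L that]])
    then show ?thesis
      by (simp add: complex_eq_iff)
  qed
  then have "\<nu> \<in> annihilator L"
    by (simp add: annihilator_def)
  moreover have "z \<noteq> 0"
    using x y xyz by auto
  then have "Re (form_at \<nu> z) \<noteq> 0"
    using inner[of z] by (metis inner_eq_zero_iff)
  then have "form_at \<nu> x \<noteq> 0"
    using \<open>\<nu> \<in> annihilator L\<close> y by (auto simp: xyz annihilator_def)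
  ultimately show ?thesis by blast
qed

text \<open>
  The polynomial functions of degree less than \<open>d\<close>. The strict bound makes the zero function the
  only one at \<open>d = 0\<close>, where repeated division by a coordinate comes to an end.
\<close>

inductive poly_fun :: "nat \<Rightarrow> (complex ^ 'n::finite \<Rightarrow> complex) \<Rightarrow> bool" where
  zero: "poly_fun d (\<lambda>_. 0)"
| const: "poly_fun (Suc d) (\<lambda>_. z)"
| add: "poly_fun d p \<Longrightarrow> poly_fun d q \<Longrightarrow> poly_fun d (\<lambda>x. p x + q x)"
| coord: "poly_fun d p \<Longrightarrow> poly_fun (Suc d) (\<lambda>x. x $ i * p x)"

lemma poly_fun_0: "poly_fun d p \<Longrightarrow> d = 0 \<Longrightarrow> p = (\<lambda>_. 0)"
  by (induction rule: poly_fun.induct) auto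

lemma poly_fun_mono: "poly_fun d p \<Longrightarrow> d \<le> d' \<Longrightarrow> poly_fun d' p"
proof (induction arbitrary: d' rule: poly_fun.induct)
  case (const d z)
  then show ?case
    using poly_fun.const Suc_le_D by blast
next
  case (coord d p i)
  then show ?case
    using poly_fun.coord by (metis Suc_le_D Suc_le_mono)
qed (auto intro: poly_fun.intros)

lemma poly_fun_scale: "poly_fun d p \<Longrightarrow> poly_fun d (\<lambda>x. z * p x)"
proof (induction rule: poly_fun.induct)
  case (coord d p i)
  then show ?case
    using poly_fun.coord[OF coord.IH, of i] by (simp add: mult.left_commute)
qed (auto simp: distrib_left intro: poly_fun.intros)

lemma poly_fun_mult:
  "poly_fun d p \<Longrightarrow> poly_fun d' q \<Longrightarrow> poly_fun (d + d') (\<lambda>x. p x * q x)"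
proof (induction rule: poly_fun.induct)
  case (const d z)
  then show ?case
    using poly_fun_mono[OF poly_fun_scale[OF const], of "Suc d + d'" z] by simp
next
  case (coord d p i)
  then show ?case
    using poly_fun.coord[OF coord.IH, of i] by (simp add: mult.assoc)
qed (auto simp: distrib_right intro: poly_fun.intros)

lemma continuous_poly_fun:
  assumes "poly_fun d p" and "continuous_on X w"
  shows "continuous_on X (\<lambda>t. p (w t))"
  using assms(1) by (induction rule: poly_fun.induct) (auto intro!: continuous_intros assms(2))

text \<open>Here \<open>x \<mapsto> x - x\<^sub>e a\<close> is the projection along \<open>a\<close>, where \<open>a\<^sub>e = 1\<close>, to the hyperplane \<open>x\<^sub>e = 0\<close>.\<close>

lemma poly_fun_projection:
  "poly_fun d p \<Longrightarrow> poly_fun d (\<lambda>x. p (x - x $ e *s a))"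
proof (induction rule: poly_fun.induct)
  case (coord d p i)
  have "poly_fun (Suc d) (\<lambda>x. x $ i * p (x - x $ e *s a) + (- (a $ i)) * (x $ e * p (x - x $ e *s a)))"
    using coord.IH by (intro poly_fun.add poly_fun.coord poly_fun_scale)
  then show ?case
    by (simp add: algebra_simps)
qed (auto intro: poly_fun.intros)

lemma poly_fun_divide:
  "poly_fun d p \<Longrightarrow> \<exists>r. poly_fun (d - 1) r \<and> (\<forall>x. p x = p (x - x $ e *s a) + x $ e * r x)"
proof (induction rule: poly_fun.induct)
  case (add d p q)
  then obtain r s where rs: "poly_fun (d - 1) r" "poly_fun (d - 1) s"
    "\<forall>x. p x = p (x - x $ e *s a) + x $ e * r x"
    "\<forall>x. q x = q (x - x $ e *s a) + x $ e * s x"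
    by auto
  have "p x + q x = p (x - x $ e *s a) + q (x - x $ e *s a) + x $ e * (r x + s x)" for x
    using rs(3)[rule_format, of x] rs(4)[rule_format, of x] by (simp add: algebra_simps)
  then show ?case
    using poly_fun.add[OF rs(1,2)] by blast
next
  case (coord d p i)
  show ?case
  proof (cases d)
    case 0
    then show ?thesis
      using poly_fun_0[OF coord.hyps] by (auto intro: poly_fun.zero)
  next
    case (Suc d')
    obtain r where r: "poly_fun d' r" "\<forall>x. p x = p (x - x $ e *s a) + x $ e * r x"
      using coord.IH Suc by auto
    have "poly_fun d (\<lambda>x. a $ i * p (x - x $ e *s a) + x $ i * r x)"
      unfolding Suc using r(1) coord.hyps Suc
      by (intro poly_fun.add poly_fun.coord poly_fun_scale poly_fun_projection) auto
    moreover have "x $ i * p x = (x - x $ e *s a) $ i * p (x - x $ e *s a) +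
        x $ e * (a $ i * p (x - x $ e *s a) + x $ i * r x)" for x
      by (subst r(2)[rule_format, of x]) (simp add: algebra_simps)
    ultimately show ?thesis
      by (auto intro!: exI[of _ "\<lambda>x. a $ i * p (x - x $ e *s a) + x $ i * r x"])
  qed
qed (auto intro: poly_fun.zero)

text \<open>
  In the language of matroids, the image of \<open>L\<close> under \<open>drop_coord e\<close> is its deletion at \<open>e\<close> and
  \<open>{g \<in> L. g $ e = 0}\<close> is its contraction. Both stay in \<open>\<complex>\<^sup>n\<close>, with \<open>e\<close> as a loop.
\<close>

definition drop_coord :: "'n \<Rightarrow> complex ^ 'n \<Rightarrow> complex ^ ('n::finite)" where
  "drop_coord e x = (\<chi> i. if i = e then 0 else x $ i)"

lemma drop_coord_nth [simp]: "drop_coord e x $ i = (if i = e then 0 else x $ i)"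
  by (simp add: drop_coord_def)

lemma drop_coord_id: "x $ e = 0 \<Longrightarrow> drop_coord e x = x"
  by (auto simp: vec_eq_iff)

lemma drop_coord_linear:
  "drop_coord e (x + y) = drop_coord e x + drop_coord e y"
  "drop_coord e (z *s x) = z *s drop_coord e x"
  by (auto simp: vec_eq_iff)

lemma subspace_drop_coord:
  assumes "vec.subspace L"
  shows "vec.subspace (drop_coord e ` L)"
  unfolding vec.subspace_def
proof (intro conjI ballI allI)
  show "0 \<in> drop_coord e ` L"
    using vec.subspace_0[OF assms] drop_coord_id[of 0 e] by force
qed (use assms in \<open>auto simp: drop_coord_linear[symmetric] vec.subspace_add vec.subspace_scale\<close>)

lemma mult_smult_vec:
  fixes v g :: "complex ^ 'n"
  shows "v * (z *s g) = z *s (v * g)"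
  by (simp add: vec_eq_iff)

lemma form_at_mult: "form_at (a * b) d = form_at a (b * d)"
  by (simp add: form_at_eq mult.assoc)

lemma form_at_drop_coord: "form_at (drop_coord e a) b = form_at a (drop_coord e b)"
  unfolding form_at_eq by (intro sum.cong) auto

lemma deletion_decompose:
  assumes "vec.subspace L" and "g0 \<in> L" and "g0 $ e = 1" and "g \<in> L"
  shows "g - g $ e *s g0 \<in> {g \<in> L. g $ e = 0}"
    and "drop_coord e g = (g - g $ e *s g0) + g $ e *s drop_coord e g0"
  using assms by (auto simp: vec.subspace_diff vec.subspace_scale vec_eq_iff)

lemma contraction_subset_deletion: "{g \<in> L. g $ e = 0} \<subseteq> drop_coord e ` L"
  using drop_coord_id by force

text \<open>
  Let \<open>K\<close> be the contraction and \<open>D\<close> the deletion, so \<open>K \<subseteq> D\<close> has codimension at most one. If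
  \<open>v D \<subseteq> D\<close> and \<open>k \<in> K\<close> but \<open>v k \<notin> K\<close>, then \<open>D = K + \<complex> v k\<close>; and \<open>w K \<subseteq> K\<close> gives
  \<open>w v k = v (w k) \<in> D\<close>, so \<open>w D \<subseteq> D\<close>.
\<close>

lemma multipliers_dichotomy:
  fixes L :: "(complex ^ 'n::finite) set"
  assumes L: "vec.subspace L" and g0: "g0 \<in> L" "g0 $ e = 1"
  shows "multipliers (drop_coord e ` L) \<subseteq> multipliers {g \<in> L. g $ e = 0} \<or>
    multipliers {g \<in> L. g $ e = 0} \<subseteq> multipliers (drop_coord e ` L)"
proof (rule ccontr)
  let ?D = "drop_coord e ` L" and ?K = "{g \<in> L. g $ e = 0}"
  note decompose = deletion_decompose[OF L g0]
  have KD: "?K \<subseteq> ?D"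
    by (rule contraction_subset_deletion)
  have subD: "vec.subspace ?D"
    by (rule subspace_drop_coord[OF L])
  assume "\<not> ?thesis"
  then obtain v w where v: "v \<in> multipliers ?D" "v \<notin> multipliers ?K"
    and w: "w \<in> multipliers ?K" "w \<notin> multipliers ?D"
    by blast
  obtain k where k: "k \<in> ?K" "v * k \<notin> ?K"
    using v(2) unfolding multipliers_def by blast
  have "v * k \<in> ?D"
    using v(1) k(1) KD unfolding multipliers_def by blast
  then obtain h where h: "h \<in> L" "v * k = drop_coord e h"
    by blast
  define k2 where "k2 = h - h $ e *s g0"
  have k2: "k2 \<in> ?K" and vk: "v * k = k2 + h $ e *s drop_coord e g0"
    using decompose[OF h(1)] h(2) unfolding k2_def by auto
  have c: "h $ e \<noteq> 0"
    using k(2) k2 unfolding vk by auto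
  have "w * drop_coord e g0 = (1 / h $ e) *s (v * (w * k) - w * k2)"
  proof -
    have "w * (v * k) = w * k2 + h $ e *s (w * drop_coord e g0)"
      unfolding vk by (simp add: distrib_left mult_smult_vec)
    then have "v * (w * k) - w * k2 = h $ e *s (w * drop_coord e g0)"
      by (simp add: mult.left_commute)
    then show ?thesis
      using c by (simp only: vec.scale_scale) simp
  qed
  moreover have "w * k \<in> ?K" "w * k2 \<in> ?K"
    using w(1) k(1) k2 unfolding multipliers_def by blast+
  then have "v * (w * k) \<in> ?D" "w * k2 \<in> ?D"
    using v(1) KD unfolding multipliers_def by blast+
  ultimately have wg0: "w * drop_coord e g0 \<in> ?D"
    using subD by (simp add: vec.subspace_diff vec.subspace_scale)
  have "w * drop_coord e g \<in> ?D" if g: "g \<in> L" for g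
  proof -
    have "w * (g - g $ e *s g0) \<in> ?K"
      using w(1) decompose(1)[OF g] unfolding multipliers_def by blast
    then have "w * (g - g $ e *s g0) + g $ e *s (w * drop_coord e g0) \<in> ?D"
      using wg0 KD subD by (blast intro: vec.subspace_add vec.subspace_scale)
    then show ?thesis
      unfolding decompose(2)[OF g] by (simp only: distrib_left mult_smult_vec)
  qed
  then show False
    using w(2) unfolding multipliers_def by blast
qed

text \<open>
  \<open>L\<close> is spanned by \<open>g0\<close> and the contraction. On the contraction the entry \<open>v $ e\<close> has no effect; as
  \<open>v\<close> is a multiplier of the deletion, this entry can be chosen so that \<open>v * g0\<close> falls into \<open>L\<close>.
\<close>

lemma multiplier_extend:
  fixes L :: "(complex ^ 'n::finite) set"
  assumes L: "vec.subspace L" and g0: "g0 \<in> L" "g0 $ e = 1"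
    and v: "v \<in> multipliers (drop_coord e ` L)" "v \<in> multipliers {g \<in> L. g $ e = 0}"
  shows "\<exists>w\<in>multipliers L. \<forall>i. i \<noteq> e \<longrightarrow> w $ i = v $ i"
proof -
  obtain h where h: "h \<in> L" "v * drop_coord e g0 = drop_coord e h"
    using v(1) g0(1) unfolding multipliers_def by blast
  define w where "w = (\<chi> i. if i = e then h $ e else v $ i)"
  have "w * g0 = h"
  proof -
    have "w $ i * g0 $ i = h $ i" for i
      using g0(2) arg_cong[OF h(2), of "\<lambda>x. x $ i"] by (cases "i = e") (auto simp: w_def)
    then show ?thesis
      by (simp add: vec_eq_iff)
  qed
  have "w * g \<in> L" if g: "g \<in> L" for g
  proof -
    let ?k = "g - g $ e *s g0"
    have k: "?k \<in> {g \<in> L. g $ e = 0}"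
      by (rule deletion_decompose(1)[OF L g0 g])
    then have "w * ?k = v * ?k"
      by (auto simp: vec_eq_iff w_def)
    then have "w * ?k \<in> L"
      using v(2) k unfolding multipliers_def by auto
    then have "w * ?k + g $ e *s h \<in> L"
      using h(1) L by (blast intro: vec.subspace_add vec.subspace_scale)
    also have "w * ?k + g $ e *s h = w * (?k + g $ e *s g0)"
      unfolding distrib_left mult_smult_vec \<open>w * g0 = h\<close> ..
    finally show ?thesis
      by simp
  qed
  then show ?thesis
    by (intro bexI[of _ w]) (auto simp: multipliers_def w_def)
qed

lemma deletion_products:
  assumes "g \<in> drop_coord e ` L" and "\<nu> \<in> annihilator (drop_coord e ` L)"
  shows "\<exists>g'\<in>L. \<exists>\<nu>'\<in>annihilator L. g * \<nu> = g' * \<nu>'"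
proof -
  obtain h where h: "h \<in> L" "g = drop_coord e h"
    using assms(1) by blast
  have "drop_coord e \<nu> \<in> annihilator L"
    using assms(2) by (simp add: annihilator_def form_at_drop_coord)
  moreover have "g * \<nu> = h * drop_coord e \<nu>"
    by (simp add: h(2) vec_eq_iff)
  ultimately show ?thesis
    using h(1) by blast
qed

lemma contraction_products:
  assumes L: "vec.subspace L" and g0: "g0 \<in> L" "g0 $ e = 1"
    and g: "g \<in> {g \<in> L. g $ e = 0}" and \<nu>: "\<nu> \<in> annihilator {g \<in> L. g $ e = 0}"
  shows "\<exists>g'\<in>L. \<exists>\<nu>'\<in>annihilator L. g * \<nu> = g' * \<nu>'"
proof -
  \<comment> \<open>Entry \<open>e\<close>, which is multiplied by \<open>g $ e = 0\<close>, is changed to make the vector orthogonal to \<open>g0\<close>.\<close>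
  define \<nu>' where "\<nu>' = \<nu> - axis e (form_at \<nu> g0)"
  have pair: "form_at \<nu>' h = form_at \<nu> h - h $ e * form_at \<nu> g0" for h
    unfolding \<nu>'_def form_at_commute[of _ h] by (simp add: form_at_axis)
  have "form_at \<nu>' h = 0" if "h \<in> L" for h
  proof -
    have "form_at \<nu> (h - h $ e *s g0) = 0"
      using \<nu> deletion_decompose(1)[OF L g0 that] unfolding annihilator_def by blast
    then show ?thesis
      by (simp add: pair)
  qed
  then have "\<nu>' \<in> annihilator L"
    by (simp add: annihilator_def)
  moreover have "g * \<nu> = g * \<nu>'"
    using g by (auto simp: vec_eq_iff \<nu>'_def axis_def)
  ultimately show ?thesis
    using g by blast
qed

text \<open>
  The products \<open>g * \<nu>\<close> of \<open>g \<in> L\<close> and \<open>\<nu> \<in> L\<^sup>\<bottom>\<close> lie in the orthogonal space \<open>A\<close> of the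
  multipliers of \<open>L\<close>, and are Zariski dense in it. If every coordinate is a loop (zero on \<open>L\<close>) or a
  coloop (its unit vector is in \<open>L\<close>), then every \<open>v\<close> is a multiplier and \<open>A = 0\<close>. Otherwise let \<open>e\<close>
  be neither. By induction the products for a suitable \<open>N\<close>, the deletion or the contraction, which
  are also products for \<open>L\<close>, are dense in a space that
  contains the hyperplane \<open>\<lambda>\<^sub>e = 0\<close> of \<open>A\<close>. So a polynomial that vanishes on the products for \<open>L\<close> is
  divisible by \<open>\<lambda>\<^sub>e\<close> on \<open>A\<close>; since \<open>\<lambda>\<^sub>e\<close> is generically nonzero on the products, the quotient vanishes
  on them as well, and the division can be repeated until the degree is exhausted.
\<close>

lemma products_dense:
  fixes L :: "(complex ^ 'n::finite) set"
  assumes "vec.subspace L" and "poly_fun d p"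
    and "\<And>g \<nu>. g \<in> L \<Longrightarrow> \<nu> \<in> annihilator L \<Longrightarrow> p (g * \<nu>) = 0"
    and "\<And>v. v \<in> multipliers L \<Longrightarrow> form_at v lam = 0"
  shows "p lam = 0"
  using assms
proof (induction "card {i. (\<exists>g\<in>L. g $ i \<noteq> 0) \<and> axis i 1 \<notin> L}" arbitrary: L d p lam rule: less_induct)
  case less
  note L = less.prems(1)
  let ?active = "\<lambda>L :: (complex ^ 'n) set. {i. (\<exists>g\<in>L. g $ i \<noteq> 0) \<and> axis i 1 \<notin> L}"
  define A where "A = {lam. \<forall>v\<in>multipliers L. form_at v lam = 0}"
  have lam: "lam \<in> A"
    using less.prems(4) by (simp add: A_def)
  have subA: "vec.subspace A"
    by (auto simp: vec.subspace_def A_def)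
  show ?case
  proof (cases "?active L = {}")
    case True
    have "v * g \<in> L" if g: "g \<in> L" for v g
    proof -
      have "v * g = (\<Sum>i\<in>UNIV. (v $ i * g $ i) *s axis i 1)"
        by (simp add: vec_eq_iff axis_def if_distrib[of "\<lambda>u. _ * u"] cong: if_cong)
      also have "\<dots> \<in> L"
      proof (rule vec.subspace_sum[OF L])
        fix i
        show "(v $ i * g $ i) *s axis i 1 \<in> L"
          using True g L by (cases "g $ i = 0") (auto intro: vec.subspace_scale vec.subspace_0)
      qed
      finally show ?thesis .
    qed
    then have "axis i 1 \<in> multipliers L" for i
      by (simp add: multipliers_def)
    then have "form_at lam (axis i 1) = 0" for i
      using less.prems(4)[of "axis i 1"] by (simp add: form_at_commute)
    then have "lam = 0 * 0"
      by (simp add: form_at_axis vec_eq_iff)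
    then show ?thesis
      using less.prems(3)[of 0 0] vec.subspace_0[OF L] vec.subspace_0[OF subspace_annihilator[of L]]
      by simp
  next
    case False
    then obtain e h where e: "h \<in> L" "h $ e \<noteq> 0" "axis e 1 \<notin> L"
      by blast
    define g0 where "g0 = (1 / h $ e) *s h"
    have g0: "g0 \<in> L" "g0 $ e = 1"
      using e L by (auto simp: g0_def vec.subspace_scale)
    obtain \<nu>1 where \<nu>1: "\<nu>1 \<in> annihilator L" "\<nu>1 $ e \<noteq> 0"
      using annihilator_separates[OF L e(3)] by (auto simp: form_at_axis)
    let ?D = "drop_coord e ` L" and ?K = "{g \<in> L. g $ e = 0}"
    obtain N where N: "N = ?D \<or> N = ?K"
      and multN: "multipliers N \<subseteq> multipliers ?D \<inter> multipliers ?K"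
      using multipliers_dichotomy[OF L g0] by blast
    have "vec.subspace ?K"
      using L unfolding vec.subspace_def by simp
    then have subN: "vec.subspace N"
      using N subspace_drop_coord[OF L] by metis
    have "?active N \<subseteq> ?active L - {e}"
    proof -
      have "axis i 1 \<in> N" if "axis i 1 \<in> L" "i \<noteq> e" for i
      proof -
        have "axis i 1 \<in> ?K"
          using that by (simp add: axis_def)
        then show ?thesis
          using N contraction_subset_deletion[of L e] by blast
      qed
      moreover have "i \<noteq> e" "\<exists>g\<in>L. g $ i \<noteq> 0" if "g \<in> N" "g $ i \<noteq> 0" for g i
        using N that by (auto split: if_splits)
      ultimately show ?thesis
        by blast
    qed
    moreover have "e \<in> ?active L"
      using e by blast
    ultimately have "?active N \<subset> ?active L"
      by blast
    then have smaller: "card (?active N) < card (?active L)"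
      by (intro psubset_card_mono) simp_all
    have productsN: "\<exists>g'\<in>L. \<exists>\<nu>'\<in>annihilator L. g * \<nu> = g' * \<nu>'"
      if "g \<in> N" "\<nu> \<in> annihilator N" for g \<nu>
      using N that deletion_products contraction_products[OF L g0] by blast
    have on_hyperplane: "q x = 0"
      if q: "poly_fun d q" "\<And>g \<nu>. g \<in> L \<Longrightarrow> \<nu> \<in> annihilator L \<Longrightarrow> q (g * \<nu>) = 0"
        and x: "x \<in> A" "x $ e = 0" for d q x
    proof (rule less.hyps[OF smaller subN q(1)])
      show "q (g * \<nu>) = 0" if "g \<in> N" "\<nu> \<in> annihilator N" for g \<nu>
        using productsN[OF that] q(2) by metis
      fix v assume "v \<in> multipliers N"
      then obtain w where w: "w \<in> multipliers L" "\<forall>i. i \<noteq> e \<longrightarrow> w $ i = v $ i"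
        using multiplier_extend[OF L g0] multN by blast
      have "form_at v x = form_at w x"
        unfolding form_at_eq using w(2) x(2) by (intro sum.cong) (metis mult_zero_right)+
      then show "form_at v x = 0"
        using w(1) x(1) by (simp add: A_def)
    qed
    show ?thesis
    proof (cases "\<exists>a\<in>A. a $ e \<noteq> 0")
      case False
      then show ?thesis
        using on_hyperplane[OF less.prems(2,3)] lam by blast
    next
      case True
      then obtain a' where a': "a' \<in> A" "a' $ e \<noteq> 0"
        by blast
      define a where "a = (1 / a' $ e) *s a'"
      have a: "a \<in> A" "a $ e = 1"
        using a' subA by (auto simp: a_def vec.subspace_scale)
      have products_in_A: "g * \<nu> \<in> A" if "g \<in> L" "\<nu> \<in> annihilator L" for g \<nu>
      proof -
        have "form_at v (g * \<nu>) = form_at \<nu> (v * g)" for v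
          by (metis form_at_mult form_at_commute)
        then show ?thesis
          using that by (simp add: A_def multipliers_def annihilator_def)
      qed
      have "\<forall>x\<in>A. q x = 0"
        if "poly_fun d q" "\<And>g \<nu>. g \<in> L \<Longrightarrow> \<nu> \<in> annihilator L \<Longrightarrow> q (g * \<nu>) = 0" for d q
        using that
      proof (induction d arbitrary: q)
        case 0
        then show ?case
          using poly_fun_0 by fastforce
      next
        case (Suc d)
        obtain r where r: "poly_fun d r" "\<And>x. q x = q (x - x $ e *s a) + x $ e * r x"
          using poly_fun_divide[OF Suc.prems(1), of e a] by auto
        have q_eq: "q x = x $ e * r x" if "x \<in> A" for x
        proof -
          have "x - x $ e *s a \<in> A"
            using that a subA by (simp add: vec.subspace_diff vec.subspace_scale)
          moreover have "(x - x $ e *s a) $ e = 0"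
            using a by simp
          ultimately have "q (x - x $ e *s a) = 0"
            using on_hyperplane[OF Suc.prems] by blast
          then show ?thesis
            using r(2)[of x] by simp
        qed
        have "r (g * \<nu>) = 0" if g: "g \<in> L" and \<nu>: "\<nu> \<in> annihilator L" for g \<nu>
        proof -
          let ?x = "\<lambda>t. (g + t *s g0) * (\<nu> + t *s \<nu>1)"
          have x_in: "g + t *s g0 \<in> L" "\<nu> + t *s \<nu>1 \<in> annihilator L" for t
            using g g0 \<nu> \<nu>1 L subspace_annihilator[of L]
            by (auto intro: vec.subspace_add vec.subspace_scale)
          have "r (?x 0) = 0"
          proof (rule zero_off_finite_imp_zero[of "\<lambda>t. r (?x t)"])
            show "continuous_on UNIV (\<lambda>t. r (?x t))"
              unfolding times_vec_def by (intro continuous_poly_fun[OF r(1)] continuous_intros)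
            let ?B = "{t. g $ e + t * g0 $ e = 0} \<union> {t. \<nu> $ e + t * \<nu>1 $ e = 0}"
            show "finite ?B"
              using g0 \<nu>1 by (intro finite_UnI finite_affine_zeros) auto
            fix t assume "t \<notin> ?B"
            then have "?x t $ e \<noteq> 0"
              by simp
            moreover have "?x t $ e * r (?x t) = 0"
              using q_eq[OF products_in_A[OF x_in]] Suc.prems(2)[OF x_in] by simp
            ultimately show "r (?x t) = 0"
              by (metis mult_eq_0_iff)
          qed
          then show ?thesis
            by simp
        qed
        then have "\<forall>x\<in>A. r x = 0"
          using Suc.IH[OF r(1)] by blast
        then show ?case
          using q_eq by simp
      qed
      then show ?thesis
        using less.prems(2,3) lam by blast
    qed
  qed
qed

section \<open>Limits of critical points\<close>

lemma eval_S_poly_fun: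
  fixes p :: "('l::finite + 'n::finite) cpoly"
  shows "\<exists>d. poly_fun d (\<lambda>lam. eval_S (x, lam + b) p)"
proof (induction p rule: cpoly_induct)
  case (Const z)
  show ?case
    using poly_fun.const by (auto simp: eval_S_def)
next
  case (Var v)
  show ?case
  proof (cases v)
    case (Inl j)
    then show ?thesis
      using poly_fun.const by (auto simp: eval_S_def)
  next
    case (Inr i)
    have "poly_fun 2 (\<lambda>lam :: complex ^ 'n. lam $ i * 1 + b $ i)"
      unfolding numeral_2_eq_2 by (intro poly_fun.add poly_fun.coord poly_fun.const)
    then show ?thesis
      using Inr by (auto simp: eval_S_def)
  qed
next
  case (add p q)
  then obtain d d' where "poly_fun d (\<lambda>lam. eval_S (x, lam + b) p)"
    and "poly_fun d' (\<lambda>lam. eval_S (x, lam + b) q)"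
    by blast
  then have "poly_fun (max d d') (\<lambda>lam. eval_S (x, lam + b) p + eval_S (x, lam + b) q)"
    by (intro poly_fun.add) (auto elim: poly_fun_mono)
  then show ?case
    by auto
next
  case (mult p q)
  then show ?case
    using poly_fun_mult by fastforce
qed

lemma continuous_eval_S:
  assumes "continuous_on X w" and "continuous_on X z"
  shows "continuous_on X (\<lambda>t. eval_S (w t, z t) p)"
  unfolding eval_S_def
proof (rule continuous_eval_at)
  fix v
  show "continuous_on X (\<lambda>t. case_sum (($) (fst (w t, z t))) (($) (snd (w t, z t))) v)"
    using assms by (cases v) (auto intro: continuous_intros)
qed

text \<open>
  A covector that vanishes wherever the forms \<open>f\<^sub>i\<close>, \<open>i \<in> E\<close>, vanish is a combination of these forms.
\<close>

lemma covector_in_span: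
  fixes c :: "'n::finite \<Rightarrow> complex ^ 'l::finite"
  assumes "\<And>u. (\<And>i. i \<in> E \<Longrightarrow> form_at (c i) u = 0) \<Longrightarrow> form_at b u = 0"
  shows "\<exists>\<rho>. b = (\<Sum>i\<in>E. \<rho> i *s c i)"
proof -
  let ?W = "range (\<lambda>\<rho>. \<Sum>i\<in>E. \<rho> i *s c i)"
  have "vec.subspace ?W"
    unfolding vec.subspace_def
  proof (intro conjI ballI allI)
    show "0 \<in> ?W"
      by (rule range_eqI[of _ _ "\<lambda>_. 0"]) simp
    fix a assume "a \<in> ?W"
    then obtain \<rho> where \<rho>: "a = (\<Sum>i\<in>E. \<rho> i *s c i)"
      by blast
    show "z *s a \<in> ?W" for z
      unfolding \<rho> by (rule range_eqI[of _ _ "\<lambda>i. z * \<rho> i"]) (simp add: vec.scale_sum_right)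
    fix a' assume "a' \<in> ?W"
    then obtain \<rho>' where \<rho>': "a' = (\<Sum>i\<in>E. \<rho>' i *s c i)"
      by blast
    show "a + a' \<in> ?W"
      unfolding \<rho> \<rho>'
      by (rule range_eqI[of _ _ "\<lambda>i. \<rho> i + \<rho>' i"]) (simp add: vec.scale_left_distrib sum.distrib)
  qed
  moreover have "form_at u b = 0" if u: "u \<in> annihilator ?W" for u
  proof -
    have "form_at (c i) u = 0" if "i \<in> E" for i
    proof -
      have "c i = (\<Sum>j\<in>E. (if j = i then 1 else 0) *s c j)"
        using that by (simp add: if_distrib[of "\<lambda>r. r *s _"] cong: if_cong)
      then have "c i \<in> ?W"
        by (rule range_eqI[of _ _ "\<lambda>j. if j = i then 1 else 0"])
      then show ?thesis
        using u unfolding annihilator_def form_at_commute[of "c i"] by blast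
    qed
    then show ?thesis
      using assms form_at_commute by metis
  qed
  ultimately have "b \<in> ?W"
    using annihilator_separates by blast
  then show ?thesis
    by blast
qed

text \<open>
  Let \<open>E\<close> index the hyperplanes through \<open>x\<close>. Along the line \<open>x + t y\<close> put
  \<open>\<lambda>\<^sub>i(t) = \<mu>\<^sub>i(t) f\<^sub>i(x + t y)\<close>, so that \<open>\<omega> = 0\<close> at \<open>x + t y\<close> means \<open>\<Sum>\<^sub>i \<mu>\<^sub>i f\<^sub>i = 0\<close>. For
  \<open>i \<notin> E\<close> take \<open>\<mu>\<^sub>i = \<lambda>\<^sub>i / f\<^sub>i(x)\<close>; by hypothesis these terms sum to a combination
  \<open>\<Sum>\<^sub>E \<rho>\<^sub>i f\<^sub>i\<close>. For \<open>i \<in> E\<close> take \<open>\<mu>\<^sub>i = \<nu>\<^sub>i / t - \<rho>\<^sub>i\<close>, where \<open>\<Sum>\<^sub>E \<nu>\<^sub>i f\<^sub>i = 0\<close>;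
  since \<open>f\<^sub>i(x + t y) = t f\<^sub>i(y)\<close>, the pole cancels in \<open>\<lambda>\<^sub>i(t)\<close>, which tends to
  \<open>\<nu>\<^sub>i f\<^sub>i(y)\<close>.
\<close>

lemma limit_of_critical_points:
  fixes c :: "'n::finite \<Rightarrow> complex ^ 'l::finite"
  defines "E \<equiv> \<lambda>x. {i. form_at (c i) x = 0}"
  assumes vanish: "\<And>P. P \<in> Sigma_arr c \<Longrightarrow> eval_S P p = 0"
    and outer: "\<And>u. (\<And>i. i \<in> E x \<Longrightarrow> form_at (c i) u = 0) \<Longrightarrow>
      (\<Sum>i\<in>-E x. lam $ i / form_at (c i) x * form_at (c i) u) = 0"
    and inner: "\<And>u. (\<Sum>i\<in>E x. \<nu> i * form_at (c i) u) = 0"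
    and y: "\<And>i. i \<in> E x \<Longrightarrow> form_at (c i) y \<noteq> 0"
  shows "eval_S (x, \<chi> i. if i \<in> E x then \<nu> i * form_at (c i) y else lam $ i) p = 0"
proof -
  define b where "b = (\<Sum>i\<in>-E x. (lam $ i / form_at (c i) x) *s c i)"
  have form_b: "form_at b u = (\<Sum>i\<in>-E x. lam $ i / form_at (c i) x * form_at (c i) u)" for u
    by (simp add: b_def form_at_commute[of _ u] form_at_sum)
  obtain \<rho> where \<rho>: "b = (\<Sum>i\<in>E x. \<rho> i *s c i)"
    using covector_in_span[of "E x" c b] outer unfolding form_b by blast
  have balance: "(\<Sum>i\<in>E x. \<rho> i * form_at (c i) u) = form_at b u" for u
    by (simp add: \<rho> form_at_commute[of _ u] form_at_sum)
  define xt where "xt t = x + t *s y" for t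
  define lt where "lt t = (\<chi> i. if i \<in> E x then \<nu> i * form_at (c i) y - t * \<rho> i * form_at (c i) y
    else lam $ i / form_at (c i) x * form_at (c i) (xt t))" for t
  let ?B = "insert 0 (\<Union>i\<in>-E x. {t. form_at (c i) x + t * form_at (c i) y = 0})"
  have "eval_S (xt 0, lt 0) p = 0"
  proof (rule zero_off_finite_imp_zero[of "\<lambda>t. eval_S (xt t, lt t) p"])
    have "continuous_on UNIV (\<lambda>t. lt t $ i)" for i
      unfolding lt_def xt_def by (cases "i \<in> E x") (auto simp: E_def intro!: continuous_intros)
    then have "continuous_on UNIV lt"
      using continuous_on_vec_lambda[of UNIV "\<lambda>i t. lt t $ i"] by simp
    then show "continuous_on UNIV (\<lambda>t. eval_S (xt t, lt t) p)"
      unfolding xt_def by (intro continuous_eval_S continuous_intros)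
    show "finite ?B"
      unfolding finite_insert by (intro finite_UN_I finite_affine_zeros) (auto simp: E_def)
    fix t assume t: "t \<notin> ?B"
    have on_E: "form_at (c i) (xt t) = t * form_at (c i) y" if "i \<in> E x" for i
      using that by (simp add: xt_def E_def)
    have nonzero: "form_at (c i) (xt t) \<noteq> 0" for i
    proof (cases "i \<in> E x")
      case True
      then show ?thesis
        using on_E y t by simp
    next
      case False
      then show ?thesis
        using t by (simp add: xt_def)
    qed
    have "(\<Sum>i\<in>UNIV. lt t $ i * (form_at (c i) u / form_at (c i) (xt t))) = 0" for u
    proof -
      have "(\<Sum>i\<in>UNIV. lt t $ i * (form_at (c i) u / form_at (c i) (xt t))) =
          (\<Sum>i\<in>UNIV. if i \<in> E x then (1 / t) * (\<nu> i * form_at (c i) u) - \<rho> i * form_at (c i) u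
            else lam $ i / form_at (c i) x * form_at (c i) u)"
      proof (rule sum.cong)
        fix i
        show "lt t $ i * (form_at (c i) u / form_at (c i) (xt t)) =
            (if i \<in> E x then (1 / t) * (\<nu> i * form_at (c i) u) - \<rho> i * form_at (c i) u
            else lam $ i / form_at (c i) x * form_at (c i) u)"
          using nonzero[of i] t on_E[of i] y[of i] by (simp add: lt_def field_simps)
      qed simp
      also have "\<dots> = (1 / t) * (\<Sum>i\<in>E x. \<nu> i * form_at (c i) u)
          - (\<Sum>i\<in>E x. \<rho> i * form_at (c i) u)
          + (\<Sum>i\<in>-E x. lam $ i / form_at (c i) x * form_at (c i) u)"
        by (subst sum.If_cases) (simp_all add: sum_subtractf sum_distrib_left)
      also have "\<dots> = 0"
        by (simp only: inner balance form_b) simp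
      finally show ?thesis .
    qed
    then show "eval_S (xt t, lt t) p = 0"
      using nonzero by (intro vanish) (simp add: Sigma_arr_eq)
  qed
  moreover have "xt 0 = x"
    by (simp add: xt_def)
  moreover have "lt 0 = (\<chi> i. if i \<in> E x then \<nu> i * form_at (c i) y else lam $ i)"
    by (auto simp: lt_def xt_def vec_eq_iff E_def)
  ultimately show ?thesis
    by simp
qed

text \<open>
  The part \<open>lam0\<close> of \<open>lam\<close> indexed by the hyperplanes through \<open>x\<close> is varied while the rest is kept:
  the polynomial vanishes whenever \<open>lam0\<close> is replaced by a product, hence, by density of the products,
  also at \<open>lam0\<close> itself.
\<close>

lemma variety_subset_closure:
  fixes c :: "'n::finite \<Rightarrow> complex ^ 'l::finite"
  assumes c: "central_arrangement c" and P: "(x, lam) \<in> variety (log_ideal c)"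
    and vanish: "\<And>P. P \<in> Sigma_arr c \<Longrightarrow> eval_S P p = 0"
  shows "eval_S (x, lam) p = 0"
proof -
  define E where "E = {i. form_at (c i) x = 0}"
  have compl_E: "{i. form_at (c i) x \<noteq> 0} = - E"
    by (auto simp: E_def)
  note tangent = variety_tangent_field[OF c P, folded E_def, unfolded compl_E]
  \<comment> \<open>A constant vector field, parallel to the hyperplanes through \<open>x\<close>.\<close>
  have outer: "(\<Sum>i\<in>-E. lam $ i / form_at (c i) x * form_at (c i) u) = 0"
    if "\<And>i. i \<in> E \<Longrightarrow> form_at (c i) u = 0" for u
    using tangent[of "\<lambda>j. Const (u $ j)" "\<lambda>_. 0"] that by (simp add: E_def)
  define G where "G y = (\<chi> i. if i \<in> E then form_at (c i) y else 0)" for y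
  have G_linear: "G (y + y') = G y + G y'" "G (z *s y) = z *s G y" "G 0 = 0" for y y' z
    by (auto simp: G_def vec_eq_iff)
  have subspace: "vec.subspace (range G)"
    unfolding vec.subspace_def
  proof (intro conjI ballI allI)
    show "0 \<in> range G"
      using G_linear(3) by (metis rangeI)
  qed (auto simp flip: G_linear)
  \<comment> \<open>A multiplier comes from a linear vector field, given by its values on the coordinate vectors.\<close>
  have multiplier: "(\<Sum>i\<in>E. lam $ i * v $ i) = 0" if "v \<in> multipliers (range G)" for v
  proof -
    have "\<exists>y. v * G (axis k 1) = G y" for k
      using that unfolding multipliers_def by blast
    then obtain Y where Y: "\<And>k. v * G (axis k 1) = G (Y k)"
      by metis
    define B where "B j = linear_form (\<chi> k. Y k $ j)" for j
    have field: "(\<chi> j. eval_at (($) y) (B j)) = (\<Sum>k\<in>UNIV. y $ k *s Y k)" for y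
      by (simp add: B_def form_at_eq vec_eq_iff mult.commute)
    have eigen: "form_at (c i) (\<chi> j. eval_at (($) y) (B j)) = v $ i * form_at (c i) y" if "i \<in> E" for i y
    proof -
      have "form_at (c i) (Y k) = v $ i * c i $ k" for k
        using arg_cong[OF Y[of k], of "\<lambda>w. w $ i"] that by (simp add: G_def form_at_axis)
      then have "form_at (c i) (\<chi> j. eval_at (($) y) (B j)) = (\<Sum>k\<in>UNIV. y $ k * (v $ i * c i $ k))"
        unfolding field by (simp add: form_at_sum)
      then show ?thesis
        by (simp add: form_at_eq[of "c i" y] sum_distrib_left mult_ac)
    qed
    let ?u = "\<chi> j. eval_at (($) x) (B j)"
    have "form_at (c i) ?u = 0" if "i \<in> E" for i
      using eigen[OF that, of x] that by (simp add: E_def)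
    then have "(\<Sum>i\<in>-E. lam $ i / form_at (c i) x * form_at (c i) ?u) = 0"
      by (rule outer)
    then show ?thesis
      using tangent[of B "($) v"] eigen by (simp add: E_def)
  qed
  define b where "b = (\<chi> i. if i \<in> E then 0 else lam $ i)"
  define lam0 where "lam0 = (\<chi> i. if i \<in> E then lam $ i else 0)"
  obtain d where d: "poly_fun d (\<lambda>lam. eval_S (x, lam + b) p)"
    using eval_S_poly_fun by blast
  have "eval_S (x, lam0 + b) p = 0"
  proof (rule products_dense[OF subspace d])
    fix g \<nu> assume "g \<in> range G" and \<nu>: "\<nu> \<in> annihilator (range G)"
    then obtain y where g: "g = G y"
      by blast
    have inner: "(\<Sum>i\<in>E. \<nu> $ i * form_at (c i) u) = 0" for u
    proof -
      have "form_at \<nu> (G u) = 0"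
        using \<nu> unfolding annihilator_def by blast
      then show ?thesis
        by (simp add: form_at_eq[of \<nu>] G_def if_distrib[of "\<lambda>r. _ * r"] sum.If_cases cong: if_cong)
    qed
    have generic: "eval_S (x, G w * \<nu> + b) p = 0" if "\<And>i. i \<in> E \<Longrightarrow> form_at (c i) w \<noteq> 0" for w
    proof -
      have "G w * \<nu> + b = (\<chi> i. if i \<in> E then \<nu> $ i * form_at (c i) w else lam $ i)"
        by (auto simp: G_def b_def vec_eq_iff)
      then show ?thesis
        using limit_of_critical_points[of c p x lam "($) \<nu>" w, folded E_def] vanish outer inner that
        by simp
    qed
    have "\<exists>w\<in>UNIV. form_at (c i) w \<noteq> 0" for i
      using c form_at_nonzero[of "c i"] unfolding central_arrangement_def
      by (metis UNIV_I zero_neq_one)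
    then obtain w where w: "\<forall>i\<in>E. form_at (c i) w \<noteq> 0"
      using generic_vector[OF vec.subspace_UNIV, of E c] by auto
    have "eval_S (x, G (y + 0 *s w) * \<nu> + b) p = 0"
    proof (rule zero_off_finite_imp_zero[of "\<lambda>t. eval_S (x, G (y + t *s w) * \<nu> + b) p"])
      show "continuous_on UNIV (\<lambda>t. eval_S (x, G (y + t *s w) * \<nu> + b) p)"
        unfolding G_linear times_vec_def by (intro continuous_eval_S continuous_intros)
      let ?B = "\<Union>i\<in>E. {t. form_at (c i) y + t * form_at (c i) w = 0}"
      show "finite ?B"
        using w by (intro finite_UN_I finite_affine_zeros) auto
      fix t assume "t \<notin> ?B"
      then show "eval_S (x, G (y + t *s w) * \<nu> + b) p = 0"
        by (intro generic) auto
    qed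
    then show "eval_S (x, g * \<nu> + b) p = 0"
      by (simp add: g)
  next
    fix v assume "v \<in> multipliers (range G)"
    from multiplier[OF this] show "form_at v lam0 = 0"
      by (simp add: form_at_eq lam0_def if_distrib[of "\<lambda>r. _ * r"] sum.If_cases mult.commute cong: if_cong)
  qed
  moreover have "lam0 + b = lam"
    by (simp add: lam0_def b_def vec_eq_iff)
  ultimately show ?thesis
    by simp
qed

theorem theorem2p9:
  fixes c :: "'n::finite \<Rightarrow> complex ^ ('l::finite)"
  assumes "central_arrangement c"
    and "essential c"
  shows "variety (log_ideal c) = zariski_closure (Sigma_arr c)"
proof
  show "zariski_closure (Sigma_arr c) \<subseteq> variety (log_ideal c)"
    unfolding zariski_closure_def
    by (rule hull_minimal) (use Sigma_subset_variety[OF assms(1)] in \<open>auto simp: zariski_closed_def\<close>)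
  show "variety (log_ideal c) \<subseteq> zariski_closure (Sigma_arr c)"
  proof (rule subrelI)
    fix x lam assume P: "(x, lam) \<in> variety (log_ideal c)"
    have "(x, lam) \<in> T" if T: "zariski_closed T" "Sigma_arr c \<subseteq> T" for T
    proof -
      obtain F where F: "T = variety F"
        using T(1) by (auto simp: zariski_closed_def)
      have "eval_S (x, lam) p = 0" if "p \<in> F" for p
        using T(2) that by (intro variety_subset_closure[OF assms(1) P]) (auto simp: F variety_def)
      then show ?thesis
        by (simp add: F variety_def)
    qed
    then show "(x, lam) \<in> zariski_closure (Sigma_arr c)"
      unfolding zariski_closure_def hull_def by blast
  qed
qed

end
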